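(* Let $\mathcal{A}$ and $\mathcal{Z}$ be abelian categories and assume that $\mathcal{A}$ is extension generated by a full subcategory $\mathcal{A}_0\subset\mathcal{A}$. Then an exact functor $\Phi\colon\mathcal{A}\to\mathcal{Z}$ is fully faithful if and only if its restriction $\Phi|_{\mathcal{E}x_1(\mathcal{A}_0)}\colon\mathcal{E}x_1(\mathcal{A}_0)\to\mathcal{Z}$ is fully faithful.
   Context: Subcategories are strictly full (closed under isomorphism). For strictly full subcategories $\mathcal{B},\mathcal{C}$ of an abelian category $\mathcal{A}$, $\mathcal{B}\ast\mathcal{C}$ is the full subcategory of objects $A$ fitting into a short exact sequence $0\to B\to A\to C\to0$ with $B\in\mathcal{B}$, $C\in\mathcal{C}$; this operation is associative. $\mathcal{E}x_k(\mathcal{A}_0)=\mathcal{A}_0\ast\cdots\ast\mathcal{A}_0$ ($k+1$ factors), a full subcategory of $\mathcal{A}$; in particular $\mathcal{E}x_1(\mathcal{A}_0)=\mathcal{A}_0\ast\mathcal{A}_0$ is the first infinitesimal neighbourhood of $\mathcal{A}_0$. $\mathcal{A}$ is extension generated by $\mathcal{A}_0$ if $\mathcal{A}=\bigcup_{k\ge0}\mathcal{E}x_k(\mathcal{A}_0)$. *)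

theory Defs
  imports "HOL-Algebra.Group"
begin

section \<open>Categories\<close>

text \<open>Every arrow has one domain and one codomain, so hom-sets are disjoint. The objects and the
  arrows are carrier sets; the values of the operations outside the carriers are irrelevant.\<close>

record ('o, 'm) cat =
  Ob  :: "'o set"
  Ar  :: "'m set"
  Dom :: "'m \<Rightarrow> 'o"
  Cod :: "'m \<Rightarrow> 'o"
  Idn :: "'o \<Rightarrow> 'm"
  Cmp :: "'m \<Rightarrow> 'm \<Rightarrow> 'm" (infixl "\<odot>\<index>" 70)

definition Hom :: "('o, 'm, 'x) cat_scheme \<Rightarrow> 'o \<Rightarrow> 'o \<Rightarrow> 'm set"
  where "Hom C a b = {f \<in> Ar C. Dom C f = a \<and> Cod C f = b}"

locale category =
  fixes C :: "('o, 'm, 'x) cat_scheme" (structure)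
  assumes Dom_closed: "f \<in> Ar C \<Longrightarrow> Dom C f \<in> Ob C"
    and Cod_closed: "f \<in> Ar C \<Longrightarrow> Cod C f \<in> Ob C"
    and Idn_Hom: "a \<in> Ob C \<Longrightarrow> Idn C a \<in> Hom C a a"
    and Cmp_Hom: "f \<in> Hom C a b \<Longrightarrow> g \<in> Hom C b c \<Longrightarrow> g \<odot> f \<in> Hom C a c"
    and Cmp_assoc: "f \<in> Hom C a b \<Longrightarrow> g \<in> Hom C b c \<Longrightarrow> h \<in> Hom C c d \<Longrightarrow>
        (h \<odot> g) \<odot> f = h \<odot> (g \<odot> f)"
    and Cmp_Idn_left: "f \<in> Hom C a b \<Longrightarrow> Idn C b \<odot> f = f"
    and Cmp_Idn_right: "f \<in> Hom C a b \<Longrightarrow> f \<odot> Idn C a = f"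

definition isomorphic :: "('o, 'm, 'x) cat_scheme \<Rightarrow> 'o \<Rightarrow> 'o \<Rightarrow> bool"
  where "isomorphic C a b \<longleftrightarrow> (\<exists>f \<in> Hom C a b. \<exists>g \<in> Hom C b a.
    g \<odot>\<^bsub>C\<^esub> f = Idn C a \<and> f \<odot>\<^bsub>C\<^esub> g = Idn C b)"

definition is_mono :: "('o, 'm, 'x) cat_scheme \<Rightarrow> 'm \<Rightarrow> bool"
  where "is_mono C f \<longleftrightarrow> f \<in> Ar C \<and>
    (\<forall>a \<in> Ob C. \<forall>g \<in> Hom C a (Dom C f). \<forall>h \<in> Hom C a (Dom C f).
      f \<odot>\<^bsub>C\<^esub> g = f \<odot>\<^bsub>C\<^esub> h \<longrightarrow> g = h)"

definition is_epi :: "('o, 'm, 'x) cat_scheme \<Rightarrow> 'm \<Rightarrow> bool"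
  where "is_epi C f \<longleftrightarrow> f \<in> Ar C \<and>
    (\<forall>a \<in> Ob C. \<forall>g \<in> Hom C (Cod C f) a. \<forall>h \<in> Hom C (Cod C f) a.
      g \<odot>\<^bsub>C\<^esub> f = h \<odot>\<^bsub>C\<^esub> f \<longrightarrow> g = h)"

definition is_null :: "('o, 'm, 'x) cat_scheme \<Rightarrow> 'o \<Rightarrow> bool"
  where "is_null C z \<longleftrightarrow> z \<in> Ob C \<and>
    (\<forall>a \<in> Ob C. (\<exists>!f. f \<in> Hom C z a) \<and> (\<exists>!f. f \<in> Hom C a z))"

text \<open>A full subcategory is given by its set of objects. Following the convention of the source,
  subcategories are strictly full, that is, closed under isomorphism.\<close>

definition strictly_full :: "('o, 'm, 'x) cat_scheme \<Rightarrow> 'o set \<Rightarrow> bool"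
  where "strictly_full C S \<longleftrightarrow> S \<subseteq> Ob C \<and>
    (\<forall>a \<in> S. \<forall>b \<in> Ob C. isomorphic C a b \<longrightarrow> b \<in> S)"

definition full_subcategory :: "('o, 'm, 'x) cat_scheme \<Rightarrow> 'o set \<Rightarrow> ('o, 'm, 'x) cat_scheme"
  where "full_subcategory C S =
    C\<lparr>Ob := S, Ar := {f \<in> Ar C. Dom C f \<in> S \<and> Cod C f \<in> S}\<rparr>"

section \<open>Functors\<close>

record ('o, 'm, 'p, 'n) cat_functor =
  FOb :: "'o \<Rightarrow> 'p"
  FAr :: "'m \<Rightarrow> 'n"

locale is_functor = dom: category C + cod: category D
  for C :: "('o, 'm, 'x) cat_scheme" and D :: "('p, 'n, 'y) cat_scheme"
    and F :: "('o, 'm, 'p, 'n) cat_functor" +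
  assumes FOb_closed: "a \<in> Ob C \<Longrightarrow> FOb F a \<in> Ob D"
    and FAr_Hom: "f \<in> Hom C a b \<Longrightarrow> FAr F f \<in> Hom D (FOb F a) (FOb F b)"
    and FAr_Idn: "a \<in> Ob C \<Longrightarrow> FAr F (Idn C a) = Idn D (FOb F a)"
    and FAr_Cmp: "f \<in> Hom C a b \<Longrightarrow> g \<in> Hom C b c \<Longrightarrow>
        FAr F (g \<odot>\<^bsub>C\<^esub> f) = FAr F g \<odot>\<^bsub>D\<^esub> FAr F f"

definition fully_faithful ::
    "('o, 'm, 'x) cat_scheme \<Rightarrow> ('p, 'n, 'y) cat_scheme \<Rightarrow> ('o, 'm, 'p, 'n) cat_functor \<Rightarrow> bool"
  where "fully_faithful C D F \<longleftrightarrow> (\<forall>a \<in> Ob C. \<forall>b \<in> Ob C.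
    bij_betw (FAr F) (Hom C a b) (Hom D (FOb F a) (FOb F b)))"

definition restrict_functor ::
    "('o, 'm, 'p, 'n) cat_functor \<Rightarrow> ('o, 'm, 'x) cat_scheme \<Rightarrow> ('o, 'm, 'p, 'n) cat_functor"
  where "restrict_functor F B =
    \<lparr>FOb = restrict (FOb F) (Ob B), FAr = restrict (FAr F) (Ar B)\<rparr>"

lemma Hom_full_subcategory:
  "Hom (full_subcategory C S) a b = (if a \<in> S \<and> b \<in> S then Hom C a b else {})"
  by (auto simp: Hom_def full_subcategory_def)

lemma (in category) category_full_subcategory:
  assumes "S \<subseteq> Ob C"
  shows "category (full_subcategory C S)"
proof -
  have [simp]: "Ob (full_subcategory C S) = S" "Idn (full_subcategory C S) = Idn C"
    "Cmp (full_subcategory C S) = Cmp C"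
    by (simp_all add: full_subcategory_def)
  show ?thesis
  proof
    fix f assume "f \<in> Ar (full_subcategory C S)"
    then show "Dom (full_subcategory C S) f \<in> Ob (full_subcategory C S)"
      and "Cod (full_subcategory C S) f \<in> Ob (full_subcategory C S)"
      by (simp_all add: full_subcategory_def)
  qed (use assms Idn_Hom Cmp_Hom Cmp_assoc Cmp_Idn_left Cmp_Idn_right in
      \<open>auto simp: Hom_full_subcategory split: if_splits\<close>)
qed

lemma (in is_functor) is_functor_restrict:
  assumes "S \<subseteq> Ob C"
  shows "is_functor (full_subcategory C S) D (restrict_functor F (full_subcategory C S))"
proof -
  let ?B = "full_subcategory C S"
  interpret B: category ?B by (rule dom.category_full_subcategory[OF assms])
  have Ob: "Ob ?B = S" and Idn: "Idn ?B = Idn C" and Cmp: "Cmp ?B = Cmp C"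
    by (simp_all add: full_subcategory_def)
  have O: "FOb (restrict_functor F ?B) a = FOb F a" if "a \<in> S" for a
    using that by (simp add: restrict_functor_def Ob)
  have A: "FAr (restrict_functor F ?B) f = FAr F f" if "f \<in> Hom ?B a b" for f a b
    using that by (simp add: restrict_functor_def Hom_def)
  have H: "a \<in> S \<and> b \<in> S \<and> f \<in> Hom C a b" if "f \<in> Hom ?B a b" for f a b
    using that by (simp add: Hom_full_subcategory split: if_splits)
  show ?thesis
  proof
    fix a assume "a \<in> Ob ?B"
    then show "FOb (restrict_functor F ?B) a \<in> Ob D"
      using assms FOb_closed by (auto simp: Ob O)
  next
    fix f a b assume f: "f \<in> Hom ?B a b"
    then show "FAr (restrict_functor F ?B) f
        \<in> Hom D (FOb (restrict_functor F ?B) a) (FOb (restrict_functor F ?B) b)"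
      using H[OF f] FAr_Hom by (simp add: A O)
  next
    fix a assume a: "a \<in> Ob ?B"
    show "FAr (restrict_functor F ?B) (Idn ?B a) = Idn D (FOb (restrict_functor F ?B) a)"
      using a A[OF B.Idn_Hom[OF a]] FAr_Idn[of a] assms by (auto simp: Idn O Ob)
  next
    fix f a b g c assume fg: "f \<in> Hom ?B a b" "g \<in> Hom ?B b c"
    show "FAr (restrict_functor F ?B) (g \<odot>\<^bsub>?B\<^esub> f)
        = FAr (restrict_functor F ?B) g \<odot>\<^bsub>D\<^esub> FAr (restrict_functor F ?B) f"
      using A[OF B.Cmp_Hom[OF fg]] A[OF fg(1)] A[OF fg(2)] H[OF fg(1)] H[OF fg(2)] FAr_Cmp[of f a b g c]
      by (simp add: Cmp)
  qed
qed

section \<open>Abelian categories\<close>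

record ('o, 'm) preadd_cat = "('o, 'm) cat" +
  Add  :: "'m \<Rightarrow> 'm \<Rightarrow> 'm" (infixl "\<boxplus>\<index>" 65)
  Zero :: "'o \<Rightarrow> 'o \<Rightarrow> 'm"

definition Hom_group :: "('o, 'm, 'x) preadd_cat_scheme \<Rightarrow> 'o \<Rightarrow> 'o \<Rightarrow> 'm monoid"
  where "Hom_group C a b =
    \<lparr>carrier = Hom C a b, mult = Add C, one = Zero C a b\<rparr>"

locale preadditive_category = category C
  for C :: "('o, 'm, 'x) preadd_cat_scheme" (structure) +
  assumes Hom_comm_group: "a \<in> Ob C \<Longrightarrow> b \<in> Ob C \<Longrightarrow> comm_group (Hom_group C a b)"
    and Cmp_Add_left: "f \<in> Hom C a b \<Longrightarrow> g \<in> Hom C b c \<Longrightarrow> h \<in> Hom C b c \<Longrightarrow>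
        (g \<boxplus> h) \<odot> f = (g \<odot> f) \<boxplus> (h \<odot> f)"
    and Cmp_Add_right: "f \<in> Hom C a b \<Longrightarrow> g \<in> Hom C a b \<Longrightarrow> h \<in> Hom C b c \<Longrightarrow>
        h \<odot> (f \<boxplus> g) = (h \<odot> f) \<boxplus> (h \<odot> g)"

definition is_kernel :: "('o, 'm, 'x) preadd_cat_scheme \<Rightarrow> 'm \<Rightarrow> 'm \<Rightarrow> bool"
  where "is_kernel C k f \<longleftrightarrow> k \<in> Ar C \<and> f \<in> Ar C \<and> Cod C k = Dom C f \<and>
    f \<odot>\<^bsub>C\<^esub> k = Zero C (Dom C k) (Cod C f) \<and>
    (\<forall>a \<in> Ob C. \<forall>g \<in> Hom C a (Dom C f). f \<odot>\<^bsub>C\<^esub> g = Zero C a (Cod C f) \<longrightarrow>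
      (\<exists>!u. u \<in> Hom C a (Dom C k) \<and> k \<odot>\<^bsub>C\<^esub> u = g))"

definition is_cokernel :: "('o, 'm, 'x) preadd_cat_scheme \<Rightarrow> 'm \<Rightarrow> 'm \<Rightarrow> bool"
  where "is_cokernel C q f \<longleftrightarrow> q \<in> Ar C \<and> f \<in> Ar C \<and> Dom C q = Cod C f \<and>
    q \<odot>\<^bsub>C\<^esub> f = Zero C (Dom C f) (Cod C q) \<and>
    (\<forall>a \<in> Ob C. \<forall>g \<in> Hom C (Cod C f) a. g \<odot>\<^bsub>C\<^esub> f = Zero C (Dom C f) a \<longrightarrow>
      (\<exists>!u. u \<in> Hom C (Cod C q) a \<and> u \<odot>\<^bsub>C\<^esub> q = g))"

text \<open>Mac Lane's definition: an Ab-category with a null object and binary biproducts, in which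
  every arrow has a kernel and a cokernel, every monic arrow is a kernel and every epi is a
  cokernel. A biproduct is an object \<open>c\<close> with injections \<open>i\<close>, \<open>j\<close> and projections \<open>p\<close>, \<open>q\<close>.\<close>

locale abelian_category = preadditive_category C
  for C :: "('o, 'm, 'x) preadd_cat_scheme" (structure) +
  assumes ex_null: "\<exists>z. is_null C z"
    and ex_biproduct: "a \<in> Ob C \<Longrightarrow> b \<in> Ob C \<Longrightarrow>
        \<exists>c \<in> Ob C. \<exists>i \<in> Hom C a c. \<exists>j \<in> Hom C b c. \<exists>p \<in> Hom C c a. \<exists>q \<in> Hom C c b.
          p \<odot> i = Idn C a \<and> q \<odot> j = Idn C b \<and> (i \<odot> p) \<boxplus> (j \<odot> q) = Idn C c"
    and ex_kernel: "f \<in> Ar C \<Longrightarrow> \<exists>k. is_kernel C k f"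
    and ex_cokernel: "f \<in> Ar C \<Longrightarrow> \<exists>q. is_cokernel C q f"
    and mono_is_kernel: "is_mono C m \<Longrightarrow> \<exists>f. is_kernel C m f"
    and epi_is_cokernel: "is_epi C e \<Longrightarrow> \<exists>f. is_cokernel C e f"

text \<open>\<open>0 \<rightarrow> b \<rightarrow> a \<rightarrow> c \<rightarrow> 0\<close> with arrows \<open>i\<close> and \<open>p\<close>.\<close>

definition short_exact ::
    "('o, 'm, 'x) preadd_cat_scheme \<Rightarrow> 'o \<Rightarrow> 'm \<Rightarrow> 'o \<Rightarrow> 'm \<Rightarrow> 'o \<Rightarrow> bool"
  where "short_exact C b i a p c \<longleftrightarrow>
    i \<in> Hom C b a \<and> p \<in> Hom C a c \<and> is_kernel C i p \<and> is_cokernel C p i"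

locale exact_functor = is_functor C D F
  for C :: "('o, 'm, 'x) preadd_cat_scheme" and D :: "('p, 'n, 'y) preadd_cat_scheme"
    and F :: "('o, 'm, 'p, 'n) cat_functor" +
  assumes FAr_Add: "f \<in> Hom C a b \<Longrightarrow> g \<in> Hom C a b \<Longrightarrow>
        FAr F (f \<boxplus>\<^bsub>C\<^esub> g) = FAr F f \<boxplus>\<^bsub>D\<^esub> FAr F g"
    and short_exact_preserved: "short_exact C b i a p c \<Longrightarrow>
        short_exact D (FOb F b) (FAr F i) (FOb F a) (FAr F p) (FOb F c)"

section \<open>Extensions\<close>

definition ext_star :: "('o, 'm, 'x) preadd_cat_scheme \<Rightarrow> 'o set \<Rightarrow> 'o set \<Rightarrow> 'o set"
  where "ext_star A \<B> \<C> =
    {a \<in> Ob A. \<exists>b \<in> \<B>. \<exists>c \<in> \<C>. \<exists>i p. short_exact A b i a p c}"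

text \<open>\<open>Exk A S k\<close> is the product of \<open>k + 1\<close> copies of \<open>S\<close>, bracketed to the right; as the
  product is associative in an abelian category, the bracketing does not matter.\<close>

primrec Exk :: "('o, 'm, 'x) preadd_cat_scheme \<Rightarrow> 'o set \<Rightarrow> nat \<Rightarrow> 'o set"
  where "Exk A S 0 = S"
  | "Exk A S (Suc k) = ext_star A S (Exk A S k)"

definition extension_generated :: "('o, 'm, 'x) preadd_cat_scheme \<Rightarrow> 'o set \<Rightarrow> bool"
  where "extension_generated A S \<longleftrightarrow> Ob A = (\<Union>k. Exk A S k)"

end

theory Submission
  imports Defs
begin

text \<open>Write \<open>S\<close> for the generating subcategory. Full faithfulness propagates along short exact
  sequences by the five lemma, provided that one carries more than the Hom-sets: if
  \<open>0 \<rightarrow> b' \<rightarrow> b \<rightarrow> b'' \<rightarrow> 0\<close> is exact, then the long exact sequence of \<open>Hom(a, -)\<close> reaches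
  \<open>Ext\<^sup>1(a, b')\<close>, and for the bijectivity on \<open>Hom(a, b)\<close> one needs that the functor is injective on
  this group. The property \<open>hom_iso_ext1_injective\<close> of a pair \<open>(a, b)\<close>, namely bijectivity on
  \<open>Hom(a, b)\<close> together with injectivity on \<open>Ext\<^sup>1(a, b)\<close>, does propagate: it passes from
  \<open>(a, b')\<close> and \<open>(a, b'')\<close> to \<open>(a, b)\<close> (\<open>hom_iso_ext1_injective_extension_right\<close>), and dually in
  the first argument (\<open>hom_iso_ext1_injective_extension_left\<close>). Since every object is an iterated
  extension of objects of \<open>S\<close>, it suffices to treat pairs of objects of \<open>S\<close>.

  This is where the first neighbourhood enters. An extension \<open>e\<close> of \<open>a \<in> S\<close> by \<open>b \<in> S\<close> is an object
  of \<open>S * S\<close>, and so is \<open>a\<close>, because \<open>S\<close> contains a null object. Thus a splitting of the image of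
  \<open>e\<close>, an arrow from the image of \<open>a\<close> to the image of \<open>e\<close>, comes from an arrow \<open>a \<rightarrow> e\<close>, and that
  arrow splits \<open>e\<close> (\<open>hom_iso_ext1_injective_if_neighbourhood\<close>).

  No Ext groups are constructed. Injectivity on \<open>Ext\<^sup>1\<close> is the statement that an extension splits
  if its image does; pulling extensions back turns it into a lifting property
  (\<open>ext1_injective_lift\<close>), which takes the place of the connecting homomorphism. The dual halves
  of all arguments are obtained from the opposite category.\<close>

section \<open>Arithmetic of arrows\<close>

context category
begin

lemma Hom_Ob: "f \<in> Hom C a b \<Longrightarrow> a \<in> Ob C" "f \<in> Hom C a b \<Longrightarrow> b \<in> Ob C"
  using Dom_closed Cod_closed by (auto simp: Hom_def)

end

context preadditive_category
begin

lemma Zero_Hom: "a \<in> Ob C \<Longrightarrow> b \<in> Ob C \<Longrightarrow> Zero C a b \<in> Hom C a b"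
  using monoid.one_closed[of "Hom_group C a b"] Hom_comm_group[of a b]
  by (simp add: Hom_group_def comm_group_def comm_monoid_def)

lemma Add_Hom: "f \<in> Hom C a b \<Longrightarrow> g \<in> Hom C a b \<Longrightarrow> f \<boxplus> g \<in> Hom C a b"
  using monoid.m_closed[of "Hom_group C a b"] Hom_comm_group[of a b] Hom_Ob[of f a b]
  by (simp add: Hom_group_def comm_group_def comm_monoid_def)

lemma Add_assoc:
  "f \<in> Hom C a b \<Longrightarrow> g \<in> Hom C a b \<Longrightarrow> h \<in> Hom C a b \<Longrightarrow> (f \<boxplus> g) \<boxplus> h = f \<boxplus> (g \<boxplus> h)"
  using monoid.m_assoc[of "Hom_group C a b"] Hom_comm_group[of a b] Hom_Ob[of f a b]
  by (simp add: Hom_group_def comm_group_def comm_monoid_def)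

lemma Add_comm: "f \<in> Hom C a b \<Longrightarrow> g \<in> Hom C a b \<Longrightarrow> f \<boxplus> g = g \<boxplus> f"
  using comm_monoid.m_comm[of "Hom_group C a b"] Hom_comm_group[of a b] Hom_Ob[of f a b]
  by (simp add: Hom_group_def comm_group_def)

lemma Add_Zero: "f \<in> Hom C a b \<Longrightarrow> f \<boxplus> Zero C a b = f" "f \<in> Hom C a b \<Longrightarrow> Zero C a b \<boxplus> f = f"
  using monoid.r_one[of "Hom_group C a b"] monoid.l_one[of "Hom_group C a b"]
    Hom_comm_group[of a b] Hom_Ob[of f a b]
  by (simp_all add: Hom_group_def comm_group_def comm_monoid_def)

lemma ex_neg:
  assumes f: "f \<in> Hom C a b"
  shows "\<exists>n \<in> Hom C a b. f \<boxplus> n = Zero C a b"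
proof -
  interpret G: comm_group "Hom_group C a b"
    using Hom_comm_group Hom_Ob f by blast
  show ?thesis
    using G.r_inv[of f] G.inv_closed[of f] f by (auto simp: Hom_group_def)
qed

lemma Add_cancel:
  assumes "f \<in> Hom C a b" "g \<in> Hom C a b" "h \<in> Hom C a b" "f \<boxplus> g = f \<boxplus> h"
  shows "g = h"
proof -
  interpret G: comm_group "Hom_group C a b"
    using Hom_comm_group Hom_Ob assms by blast
  show ?thesis
    using G.Units_l_cancel[of f g h] G.Units_eq assms by (simp add: Hom_group_def)
qed

lemma Add_eq_left_Zero:
  assumes "f \<in> Hom C a b" "g \<in> Hom C a b" "f \<boxplus> g = f"
  shows "g = Zero C a b"
  using Add_cancel[of f a b g "Zero C a b"] Add_Zero Zero_Hom Hom_Ob assms by metis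

lemma Cmp_Zero_right:
  assumes f: "f \<in> Hom C b c" and a: "a \<in> Ob C"
  shows "f \<odot> Zero C a b = Zero C a c"
proof -
  have z: "Zero C a b \<in> Hom C a b" using Zero_Hom a Hom_Ob f by blast
  have "f \<odot> Zero C a b \<boxplus> f \<odot> Zero C a b = f \<odot> Zero C a b"
    using Cmp_Add_right[OF z z f] Add_Zero(1)[OF z] by simp
  then show ?thesis using Add_eq_left_Zero Cmp_Hom z f by blast
qed

lemma Cmp_Zero_left:
  assumes f: "f \<in> Hom C a b" and c: "c \<in> Ob C"
  shows "Zero C b c \<odot> f = Zero C a c"
proof -
  have z: "Zero C b c \<in> Hom C b c" using Zero_Hom c Hom_Ob f by blast
  have "Zero C b c \<odot> f \<boxplus> Zero C b c \<odot> f = Zero C b c \<odot> f"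
    using Cmp_Add_left[OF f z z] Add_Zero(1)[OF z] by simp
  then show ?thesis using Add_eq_left_Zero Cmp_Hom z f by blast
qed

lemma epi_if_cancels_Zero:
  assumes p: "p \<in> Hom C e c"
    and zero: "\<And>x h. h \<in> Hom C c x \<Longrightarrow> h \<odot> p = Zero C e x \<Longrightarrow> h = Zero C c x"
  shows "is_epi C p"
  unfolding is_epi_def
proof (intro conjI ballI impI)
  show "p \<in> Ar C" using p by (simp add: Hom_def)
  fix x g h assume x: "x \<in> Ob C" and g: "g \<in> Hom C (Cod C p) x" and h: "h \<in> Hom C (Cod C p) x"
    and eq: "g \<odot> p = h \<odot> p"
  have g': "g \<in> Hom C c x" and h': "h \<in> Hom C c x" using g h p by (simp_all add: Hom_def)
  obtain n where n: "n \<in> Hom C c x" "h \<boxplus> n = Zero C c x" using ex_neg[OF h'] by blast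
  have "(g \<boxplus> n) \<odot> p = (h \<boxplus> n) \<odot> p"
    using Cmp_Add_left[OF p g' n(1)] Cmp_Add_left[OF p h' n(1)] eq by simp
  also have "\<dots> = Zero C e x" using n Cmp_Zero_left[OF p x] by simp
  finally have "g \<boxplus> n = h \<boxplus> n" using zero[OF Add_Hom[OF g' n(1)]] n by simp
  then show "g = h" using Add_cancel[of n c x g h] Add_comm g' h' n by metis
qed

end

section \<open>The opposite category\<close>

definition opposite :: "('o, 'm, 'x) preadd_cat_scheme \<Rightarrow> ('o, 'm, 'x) preadd_cat_scheme"
  where "opposite C = C\<lparr>Dom := Cod C, Cod := Dom C, Cmp := \<lambda>g f. Cmp C f g,
    Zero := \<lambda>a b. Zero C b a\<rparr>"

lemma opposite_simps [simp]:
  "Ob (opposite C) = Ob C" "Ar (opposite C) = Ar C" "Dom (opposite C) = Cod C"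
  "Cod (opposite C) = Dom C" "Idn (opposite C) = Idn C" "g \<odot>\<^bsub>opposite C\<^esub> f = f \<odot>\<^bsub>C\<^esub> g"
  "Add (opposite C) = Add C" "Zero (opposite C) a b = Zero C b a"
  by (simp_all add: opposite_def)

lemma opposite_Hom [simp]: "Hom (opposite C) a b = Hom C b a"
  by (auto simp: Hom_def)

lemma opposite_mono_epi [simp]:
  "is_mono (opposite C) f \<longleftrightarrow> is_epi C f" "is_epi (opposite C) f \<longleftrightarrow> is_mono C f"
  by (simp_all add: is_mono_def is_epi_def)

lemma opposite_kernel_cokernel [simp]:
  "is_kernel (opposite C) k f \<longleftrightarrow> is_cokernel C k f"
  "is_cokernel (opposite C) k f \<longleftrightarrow> is_kernel C k f"
  by (auto simp: is_kernel_def is_cokernel_def)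

lemma is_kernel_iff:
  assumes "k \<in> Hom C b a" "f \<in> Hom C a c"
  shows "is_kernel C k f \<longleftrightarrow> f \<odot>\<^bsub>C\<^esub> k = Zero C b c \<and>
    (\<forall>x \<in> Ob C. \<forall>g \<in> Hom C x a. f \<odot>\<^bsub>C\<^esub> g = Zero C x c \<longrightarrow>
      (\<exists>!u. u \<in> Hom C x b \<and> k \<odot>\<^bsub>C\<^esub> u = g))"
proof -
  have "k \<in> Ar C" "Dom C k = b" "Cod C k = a" "f \<in> Ar C" "Dom C f = a" "Cod C f = c"
    using assms by (auto simp: Hom_def)
  then show ?thesis by (simp add: is_kernel_def)
qed

lemma is_cokernel_iff:
  assumes "q \<in> Hom C a c" "f \<in> Hom C b a"
  shows "is_cokernel C q f \<longleftrightarrow> q \<odot>\<^bsub>C\<^esub> f = Zero C b c \<and>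
    (\<forall>x \<in> Ob C. \<forall>g \<in> Hom C a x. g \<odot>\<^bsub>C\<^esub> f = Zero C b x \<longrightarrow>
      (\<exists>!u. u \<in> Hom C c x \<and> u \<odot>\<^bsub>C\<^esub> q = g))"
  using is_kernel_iff[of q "opposite C" c a f b] assms by simp

lemma opposite_short_exact [simp]:
  "short_exact (opposite C) b i a p c \<longleftrightarrow> short_exact C c p a i b"
  by (auto simp: short_exact_def)

lemma opposite_null [simp]: "is_null (opposite C) z \<longleftrightarrow> is_null C z"
  by (auto simp: is_null_def)

lemma abelian_category_opposite:
  assumes "abelian_category C"
  shows "abelian_category (opposite C)"
proof -
  interpret abelian_category C by fact
  show ?thesis
  proof (intro abelian_category.intro preadditive_category.intro category.intro
      preadditive_category_axioms.intro abelian_category_axioms.intro)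
    fix f a b g c h d
    assume "f \<in> Hom (opposite C) a b" "g \<in> Hom (opposite C) b c" "h \<in> Hom (opposite C) c d"
    then show "(h \<odot>\<^bsub>opposite C\<^esub> g) \<odot>\<^bsub>opposite C\<^esub> f = h \<odot>\<^bsub>opposite C\<^esub> (g \<odot>\<^bsub>opposite C\<^esub> f)"
      using Cmp_assoc[of h d c g b f a] by simp
  next
    fix a b assume "a \<in> Ob (opposite C)" "b \<in> Ob (opposite C)"
    moreover have "Hom_group (opposite C) a b = Hom_group C b a"
      by (simp add: Hom_group_def)
    ultimately show "comm_group (Hom_group (opposite C) a b)"
      using Hom_comm_group by simp
  next
    show "\<exists>z. is_null (opposite C) z" using ex_null by simp
  next
    fix a b assume ab: "a \<in> Ob (opposite C)" "b \<in> Ob (opposite C)"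
    obtain c i j p q where "c \<in> Ob C" "i \<in> Hom C a c" "j \<in> Hom C b c" "p \<in> Hom C c a"
      "q \<in> Hom C c b" "p \<odot>\<^bsub>C\<^esub> i = Idn C a" "q \<odot>\<^bsub>C\<^esub> j = Idn C b"
      "(i \<odot>\<^bsub>C\<^esub> p) \<boxplus>\<^bsub>C\<^esub> (j \<odot>\<^bsub>C\<^esub> q) = Idn C c"
      using ex_biproduct[of a b] ab by auto
    then show "\<exists>c\<in>Ob (opposite C). \<exists>i\<in>Hom (opposite C) a c. \<exists>j\<in>Hom (opposite C) b c.
        \<exists>p\<in>Hom (opposite C) c a. \<exists>q\<in>Hom (opposite C) c b.
          p \<odot>\<^bsub>opposite C\<^esub> i = Idn (opposite C) a \<and> q \<odot>\<^bsub>opposite C\<^esub> j = Idn (opposite C) b \<and>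
          (i \<odot>\<^bsub>opposite C\<^esub> p) \<boxplus>\<^bsub>opposite C\<^esub> (j \<odot>\<^bsub>opposite C\<^esub> q) = Idn (opposite C) c"
      unfolding opposite_simps opposite_Hom by blast
  next
    show "\<exists>k. is_kernel (opposite C) k f" if "f \<in> Ar (opposite C)" for f
      using ex_cokernel that by simp
    show "\<exists>k. is_cokernel (opposite C) k f" if "f \<in> Ar (opposite C)" for f
      using ex_kernel that by simp
    show "\<exists>f. is_kernel (opposite C) m f" if "is_mono (opposite C) m" for m
      using epi_is_cokernel that by simp
    show "\<exists>f. is_cokernel (opposite C) m f" if "is_epi (opposite C) m" for m
      using mono_is_kernel that by simp
  qed (use Dom_closed Cod_closed Idn_Hom Cmp_Hom Cmp_Idn_left Cmp_Idn_right Cmp_Add_left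
      Cmp_Add_right in auto)
qed

section \<open>Short exact sequences\<close>

context preadditive_category
begin

lemma short_exact_Hom:
  assumes "short_exact C b i a p c"
  shows "i \<in> Hom C b a" "p \<in> Hom C a c" "p \<odot> i = Zero C b c"
  using assms by (auto simp: short_exact_def is_kernel_def Hom_def)

lemma short_exact_lift:
  assumes "short_exact C b i a p c" "f \<in> Hom C x a" "p \<odot> f = Zero C x c"
  shows "\<exists>u \<in> Hom C x b. i \<odot> u = f"
proof -
  have "x \<in> Ob C" using Hom_Ob assms by blast
  moreover have "is_kernel C i p" using assms by (simp add: short_exact_def)
  ultimately show ?thesis
    using is_kernel_iff[OF short_exact_Hom(1,2)[OF assms(1)]] assms(2,3) by blast
qed

lemma short_exact_monic:
  assumes s: "short_exact C b i a p c" and u: "u \<in> Hom C x b" and v: "v \<in> Hom C x b"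
    and eq: "i \<odot> u = i \<odot> v"
  shows "u = v"
proof -
  note h = short_exact_Hom[OF s]
  have x: "x \<in> Ob C" using Hom_Ob u by blast
  have "p \<odot> (i \<odot> u) = Zero C x c"
    using Cmp_assoc[OF u h(1,2)] h(3) Cmp_Zero_left[OF u] Hom_Ob[OF h(2)] by simp
  moreover have "is_kernel C i p" using s by (simp add: short_exact_def)
  ultimately have "\<exists>!w. w \<in> Hom C x b \<and> i \<odot> w = i \<odot> u"
    using is_kernel_iff[OF h(1,2)] x Cmp_Hom[OF u h(1)] by blast
  then show ?thesis using u v eq by metis
qed

text \<open>Two arrows that agree after \<open>p\<close> differ by one through \<open>i\<close>. With the difference on the right-hand
  side as a sum, the statement can be transported by additive functors.\<close>

lemma short_exact_diff:
  assumes s: "short_exact C b i a p c" and f: "f \<in> Hom C x a" and g: "g \<in> Hom C x a"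
    and eq: "p \<odot> f = p \<odot> g"
  shows "\<exists>d \<in> Hom C x b. f = g \<boxplus> (i \<odot> d)"
proof -
  note h = short_exact_Hom[OF s]
  have x: "x \<in> Ob C" using Hom_Ob f by blast
  obtain n where n: "n \<in> Hom C x a" "g \<boxplus> n = Zero C x a" using ex_neg[OF g] by blast
  have "p \<odot> (f \<boxplus> n) = p \<odot> (g \<boxplus> n)"
    using Cmp_Add_right[OF f n(1) h(2)] Cmp_Add_right[OF g n(1) h(2)] eq by simp
  also have "\<dots> = Zero C x c" using n Cmp_Zero_right[OF h(2) x] by simp
  finally obtain d where d: "d \<in> Hom C x b" "i \<odot> d = f \<boxplus> n"
    using short_exact_lift[OF s Add_Hom[OF f n(1)]] by blast
  have "g \<boxplus> (f \<boxplus> n) = f \<boxplus> (g \<boxplus> n)"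
    using Add_assoc Add_comm f g n by metis
  then show ?thesis using d n Add_Zero(1)[OF f] by metis
qed

end

context abelian_category
begin

lemma short_exact_colift:
  assumes "short_exact C b i a p c" "f \<in> Hom C a x" "f \<odot> i = Zero C b x"
  shows "\<exists>u \<in> Hom C c x. u \<odot> p = f"
  using preadditive_category.short_exact_lift[of "opposite C" c p a i b f x]
    abelian_category_opposite[OF abelian_category_axioms] assms
  by (simp add: abelian_category_def)

lemma short_exact_epic:
  assumes "short_exact C b i a p c" "u \<in> Hom C c x" "v \<in> Hom C c x" "u \<odot> p = v \<odot> p"
  shows "u = v"
  using preadditive_category.short_exact_monic[of "opposite C" c p a i b u x v]
    abelian_category_opposite[OF abelian_category_axioms] assms
  by (simp add: abelian_category_def)

text \<open>An epi is a cokernel of some \<open>f\<close>; it is then also a cokernel of its kernel \<open>k\<close>, since \<open>f\<close>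
  factors through \<open>k\<close>, so that every arrow that vanishes on \<open>k\<close> vanishes on \<open>f\<close>.\<close>

lemma epi_kernel_short_exact:
  assumes e: "is_epi C p" and k: "is_kernel C k p"
    and kH: "k \<in> Hom C b a" and pH: "p \<in> Hom C a c"
  shows "short_exact C b k a p c"
proof -
  obtain f where f: "is_cokernel C p f" using epi_is_cokernel[OF e] by blast
  define y where "y = Dom C f"
  have fH: "f \<in> Hom C y a" and pf: "p \<odot> f = Zero C y c"
    using f pH by (auto simp: is_cokernel_def Hom_def y_def)
  have y: "y \<in> Ob C" using Hom_Ob fH by blast
  then obtain v where v: "v \<in> Hom C y b" "k \<odot> v = f"
    using is_kernel_iff[OF kH pH] k fH pf by blast
  have "is_cokernel C p k"
    unfolding is_cokernel_iff[OF pH kH]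
  proof (intro conjI ballI impI)
    show "p \<odot> k = Zero C b c" using is_kernel_iff[OF kH pH] k by blast
    fix x g assume x: "x \<in> Ob C" and g: "g \<in> Hom C a x" and gk: "g \<odot> k = Zero C b x"
    have "g \<odot> f = Zero C y x"
      using Cmp_assoc[OF v(1) kH g] v gk Cmp_Zero_left[OF v(1) x] by simp
    then show "\<exists>!u. u \<in> Hom C c x \<and> u \<odot> p = g"
      using is_cokernel_iff[OF pH fH] f x g by blast
  qed
  then show ?thesis using k kH pH by (simp add: short_exact_def)
qed

lemma mono_cokernel_short_exact:
  assumes "is_mono C i" "is_cokernel C p i" "i \<in> Hom C b a" "p \<in> Hom C a c"
  shows "short_exact C b i a p c"
  using abelian_category.epi_kernel_short_exact[OF abelian_category_opposite[OF abelian_category_axioms],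
    of i p c a b] assms by simp

lemma epi_ex_short_exact:
  assumes "is_epi C p" "p \<in> Hom C a c"
  shows "\<exists>b k. short_exact C b k a p c"
proof -
  obtain k where k: "is_kernel C k p" using ex_kernel assms by (auto simp: Hom_def)
  then have "k \<in> Hom C (Dom C k) a" using assms by (auto simp: is_kernel_def Hom_def)
  then show ?thesis using epi_kernel_short_exact k assms by blast
qed

end


section \<open>Pullbacks of short exact sequences\<close>

definition biproduct ::
    "('o, 'm, 'x) preadd_cat_scheme \<Rightarrow> 'o \<Rightarrow> 'o \<Rightarrow> 'o \<Rightarrow> 'm \<Rightarrow> 'm \<Rightarrow> 'm \<Rightarrow> 'm \<Rightarrow> bool"
  where "biproduct C a b m i j p q \<longleftrightarrow>
    i \<in> Hom C a m \<and> j \<in> Hom C b m \<and> p \<in> Hom C m a \<and> q \<in> Hom C m b \<and>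
    p \<odot>\<^bsub>C\<^esub> i = Idn C a \<and> q \<odot>\<^bsub>C\<^esub> j = Idn C b \<and>
    (i \<odot>\<^bsub>C\<^esub> p) \<boxplus>\<^bsub>C\<^esub> (j \<odot>\<^bsub>C\<^esub> q) = Idn C m"

context preadditive_category
begin

lemma biproduct_cross:
  assumes "biproduct C a b m i j p q"
  shows "q \<odot> i = Zero C a b"
proof -
  have H: "i \<in> Hom C a m" "j \<in> Hom C b m" "p \<in> Hom C m a" "q \<in> Hom C m b"
    and pi: "p \<odot> i = Idn C a" and qj: "q \<odot> j = Idn C b"
    and sum: "(i \<odot> p) \<boxplus> (j \<odot> q) = Idn C m"
    using assms by (auto simp: biproduct_def)
  have qip: "q \<odot> (i \<odot> p) \<in> Hom C m b" and qi: "q \<odot> i \<in> Hom C a b"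
    using Cmp_Hom H by blast+
  have "q = q \<odot> ((i \<odot> p) \<boxplus> (j \<odot> q))" using sum Cmp_Idn_right[OF H(4)] by simp
  also have "\<dots> = q \<odot> (i \<odot> p) \<boxplus> q \<odot> (j \<odot> q)"
    using Cmp_Add_right[OF Cmp_Hom[OF H(3,1)] Cmp_Hom[OF H(4,2)] H(4)] .
  also have "q \<odot> (j \<odot> q) = q"
    using Cmp_assoc[OF H(4,2,4)] qj Cmp_Idn_left[OF H(4)] by simp
  finally have "q \<odot> (i \<odot> p) = Zero C m b"
    using Add_eq_left_Zero[OF H(4) qip] Add_comm[OF H(4) qip] by simp
  then have "(q \<odot> i) \<odot> p = Zero C m b" using Cmp_assoc[OF H(3,1,4)] by simp
  then have "((q \<odot> i) \<odot> p) \<odot> i = Zero C a b"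
    using Cmp_Zero_left[OF H(1)] Hom_Ob[OF H(4)] by simp
  then show ?thesis
    using Cmp_assoc[OF H(1,3) qi] pi Cmp_Idn_right[OF qi] by simp
qed

lemma biproduct_swap: "biproduct C a b m i j p q \<Longrightarrow> biproduct C b a m j i q p"
  using Add_comm[of "i \<odot> p" m m "j \<odot> q"] Cmp_Hom by (auto simp: biproduct_def)

lemma biproduct_ext:
  assumes "biproduct C a b m i j p q" and v: "v \<in> Hom C x m" and w: "w \<in> Hom C x m"
    and pv: "p \<odot> v = p \<odot> w" and qv: "q \<odot> v = q \<odot> w"
  shows "v = w"
proof -
  have H: "i \<in> Hom C a m" "j \<in> Hom C b m" "p \<in> Hom C m a" "q \<in> Hom C m b"
    and sum: "(i \<odot> p) \<boxplus> (j \<odot> q) = Idn C m"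
    using assms by (auto simp: biproduct_def)
  have "u = (i \<odot> (p \<odot> u)) \<boxplus> (j \<odot> (q \<odot> u))" if u: "u \<in> Hom C x m" for u
    using Cmp_Add_left[OF u Cmp_Hom[OF H(3,1)] Cmp_Hom[OF H(4,2)]] sum Cmp_Idn_left[OF u]
      Cmp_assoc[OF u H(3,1)] Cmp_assoc[OF u H(4,2)] by simp
  then show ?thesis using v w pv qv by metis
qed

lemma biproduct_pair:
  assumes B: "biproduct C a b m i j p q" and x: "x \<in> Hom C y a" and s: "s \<in> Hom C y b"
  shows "\<exists>v \<in> Hom C y m. p \<odot> v = x \<and> q \<odot> v = s"
proof -
  have H: "i \<in> Hom C a m" "j \<in> Hom C b m" "p \<in> Hom C m a" "q \<in> Hom C m b"
    and pi: "p \<odot> i = Idn C a" and qj: "q \<odot> j = Idn C b"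
    using B by (auto simp: biproduct_def)
  note ix = Cmp_Hom[OF x H(1)] and js = Cmp_Hom[OF s H(2)]
  note ob = Hom_Ob[OF x] Hom_Ob[OF s]
  have "p \<odot> ((i \<odot> x) \<boxplus> (j \<odot> s)) = (p \<odot> i) \<odot> x \<boxplus> (p \<odot> j) \<odot> s"
    using Cmp_Add_right[OF ix js H(3)] Cmp_assoc[OF x H(1,3)] Cmp_assoc[OF s H(2,3)] by simp
  also have "\<dots> = x"
    using pi biproduct_cross[OF biproduct_swap[OF B]] Cmp_Idn_left[OF x] Cmp_Zero_left[OF s]
      Add_Zero(1)[OF x] ob by simp
  finally have 1: "p \<odot> ((i \<odot> x) \<boxplus> (j \<odot> s)) = x" .
  have "q \<odot> ((i \<odot> x) \<boxplus> (j \<odot> s)) = (q \<odot> i) \<odot> x \<boxplus> (q \<odot> j) \<odot> s"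
    using Cmp_Add_right[OF ix js H(4)] Cmp_assoc[OF x H(1,4)] Cmp_assoc[OF s H(2,4)] by simp
  also have "\<dots> = s"
    using qj biproduct_cross[OF B] Cmp_Idn_left[OF s] Cmp_Zero_left[OF x]
      Add_Zero(2)[OF s] ob by simp
  finally show ?thesis using 1 Add_Hom[OF ix js] by blast
qed

text \<open>The kernel of \<open>a \<oplus> e \<rightarrow> c\<close>, the difference of \<open>g\<close> and \<open>p\<close>, has the lifting property of the
  pullback. The hypotheses are equations and one short exact sequence, all of which an exact
  functor preserves, so that the lemma also applies to the image of a pullback.\<close>

lemma pullback_lift:
  assumes B: "biproduct C a e m ia ie pa pe"
    and g: "g \<in> Hom C a c" and p: "p \<in> Hom C e c" and n: "n \<in> Hom C e c" and pn: "p \<boxplus> n = Zero C e c"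
    and s: "short_exact C w k m ((g \<odot> pa) \<boxplus> (n \<odot> pe)) c"
    and x: "x \<in> Hom C y a" and t: "t \<in> Hom C y e" and eq: "g \<odot> x = p \<odot> t"
  shows "\<exists>u \<in> Hom C y w. pa \<odot> (k \<odot> u) = x \<and> pe \<odot> (k \<odot> u) = t"
proof -
  have H: "pa \<in> Hom C m a" "pe \<in> Hom C m e" using B by (auto simp: biproduct_def)
  obtain v where v: "v \<in> Hom C y m" "pa \<odot> v = x" "pe \<odot> v = t"
    using biproduct_pair[OF B x t] by blast
  have "((g \<odot> pa) \<boxplus> (n \<odot> pe)) \<odot> v = (p \<odot> t) \<boxplus> (n \<odot> t)"
    using Cmp_Add_left[OF v(1) Cmp_Hom[OF H(1) g] Cmp_Hom[OF H(2) n]] eq v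
      Cmp_assoc[OF v(1) H(1) g] Cmp_assoc[OF v(1) H(2) n] by simp
  also have "\<dots> = Zero C y c"
    using Cmp_Add_left[OF t p n] pn Cmp_Zero_left[OF t] Hom_Ob[OF p] by simp
  finally obtain u where "u \<in> Hom C y w" "k \<odot> u = v"
    using short_exact_lift[OF s v(1)] by blast
  then show ?thesis using v by blast
qed

end

context abelian_category
begin

text \<open>The pullback of an extension of \<open>c\<close> by \<open>b\<close> along \<open>g : a \<rightarrow> c\<close> is an extension of \<open>a\<close> by \<open>b\<close>. It is
  returned with its presentation as the kernel of \<open>a \<oplus> e \<rightarrow> c\<close>, which is what can be carried through
  an exact functor. That the projection to \<open>a\<close> is epi is the exactness of
  \<open>0 \<rightarrow> w \<rightarrow> a \<oplus> e \<rightarrow> c \<rightarrow> 0\<close> in the middle and on the right: an arrow on \<open>a\<close> that vanishes on \<open>w\<close>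
  induces one on \<open>c\<close> that vanishes on \<open>e\<close>, hence is zero.\<close>

lemma ex_pullback:
  assumes s: "short_exact C b i e p c" and g: "g \<in> Hom C a c"
  shows "\<exists>m ia ie pa pe n w k j. biproduct C a e m ia ie pa pe \<and>
    n \<in> Hom C e c \<and> p \<boxplus> n = Zero C e c \<and>
    short_exact C w k m ((g \<odot> pa) \<boxplus> (n \<odot> pe)) c \<and>
    short_exact C b j w (pa \<odot> k) a \<and> g \<odot> (pa \<odot> k) = p \<odot> (pe \<odot> k)"
proof -
  note S = short_exact_Hom[OF s]
  note ob = Hom_Ob[OF g] Hom_Ob[OF S(1)]
  obtain m ia ie pa pe where B: "biproduct C a e m ia ie pa pe"
    using ex_biproduct[OF ob(1,4)] unfolding biproduct_def by blast
  then have H: "ia \<in> Hom C a m" "ie \<in> Hom C e m" "pa \<in> Hom C m a" "pe \<in> Hom C m e"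
    and pia: "pa \<odot> ia = Idn C a" and pie: "pe \<odot> ie = Idn C e"
    by (auto simp: biproduct_def)
  have cross: "pa \<odot> ie = Zero C e a" using biproduct_cross[OF biproduct_swap[OF B]] .
  obtain n where n: "n \<in> Hom C e c" "p \<boxplus> n = Zero C e c" using ex_neg[OF S(2)] by blast
  define r where "r = (g \<odot> pa) \<boxplus> (n \<odot> pe)"
  note gpa = Cmp_Hom[OF H(3) g] and npe = Cmp_Hom[OF H(4) n(1)]
  have r: "r \<in> Hom C m c" unfolding r_def by (rule Add_Hom[OF gpa npe])
  have "r \<odot> ie = g \<odot> (pa \<odot> ie) \<boxplus> n \<odot> (pe \<odot> ie)"
    unfolding r_def using Cmp_Add_left[OF H(2) gpa npe] Cmp_assoc[OF H(2,3) g]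
      Cmp_assoc[OF H(2,4) n(1)] by simp
  also have "\<dots> = n"
    using cross pie Cmp_Zero_right[OF g] Cmp_Idn_right[OF n(1)] Add_Zero(2)[OF n(1)] ob by simp
  finally have rie: "r \<odot> ie = n" .
  have n_epi: "h = Zero C c x" if h: "h \<in> Hom C c x" and hn: "h \<odot> n = Zero C e x" for h x
  proof -
    have "h \<odot> p = h \<odot> (p \<boxplus> n)"
      using Cmp_Add_right[OF S(2) n(1) h] hn Add_Zero(1)[OF Cmp_Hom[OF S(2) h]] by simp
    also have "\<dots> = Zero C c x \<odot> p"
      using n Cmp_Zero_right[OF h] Cmp_Zero_left[OF S(2)] Hom_Ob[OF h] ob by simp
    finally show ?thesis
      using short_exact_epic[OF s h] Zero_Hom Hom_Ob[OF h] by blast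
  qed
  have "is_epi C r"
  proof (rule epi_if_cancels_Zero[OF r])
    fix x h assume h: "h \<in> Hom C c x" and hr: "h \<odot> r = Zero C m x"
    have "h \<odot> n = Zero C e x"
      using Cmp_assoc[OF H(2) r h] rie hr Cmp_Zero_left[OF H(2)] Hom_Ob[OF h] by simp
    then show "h = Zero C c x" using n_epi h by blast
  qed
  then obtain w k where wk: "short_exact C w k m r c"
    using epi_ex_short_exact r by blast
  note K = short_exact_Hom[OF wk]
  note pk = Cmp_Hom[OF K(1) H(3)] and ek = Cmp_Hom[OF K(1) H(4)]
  note obw = Hom_Ob[OF K(1)]
  have square: "g \<odot> (pa \<odot> k) = p \<odot> (pe \<odot> k)"
  proof -
    have "n \<odot> (pe \<odot> k) \<boxplus> g \<odot> (pa \<odot> k) = g \<odot> (pa \<odot> k) \<boxplus> n \<odot> (pe \<odot> k)"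
      using Add_comm Cmp_Hom pk ek g n(1) by blast
    also have "\<dots> = r \<odot> k"
      unfolding r_def using Cmp_Add_left[OF K(1) gpa npe] Cmp_assoc[OF K(1) H(3) g]
        Cmp_assoc[OF K(1) H(4) n(1)] by simp
    also have "\<dots> = (p \<boxplus> n) \<odot> (pe \<odot> k)"
      using K(3) n Cmp_Zero_left[OF ek] ob by simp
    also have "\<dots> = n \<odot> (pe \<odot> k) \<boxplus> p \<odot> (pe \<odot> k)"
      using Cmp_Add_left[OF ek S(2) n(1)] Add_comm[OF Cmp_Hom[OF ek S(2)] Cmp_Hom[OF ek n(1)]]
      by simp
    finally show ?thesis
      using Add_cancel[OF Cmp_Hom[OF ek n(1)] Cmp_Hom[OF pk g] Cmp_Hom[OF ek S(2)]] by blast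
  qed
  have epi: "is_epi C (pa \<odot> k)"
  proof (rule epi_if_cancels_Zero[OF pk])
    fix x h assume h: "h \<in> Hom C a x" and "h \<odot> (pa \<odot> k) = Zero C w x"
    then have "(h \<odot> pa) \<odot> k = Zero C w x" using Cmp_assoc[OF K(1) H(3) h] by simp
    then obtain u where u: "u \<in> Hom C c x" "u \<odot> r = h \<odot> pa"
      using short_exact_colift[OF wk Cmp_Hom[OF H(3) h]] by blast
    have "u \<odot> n = (h \<odot> pa) \<odot> ie" using Cmp_assoc[OF H(2) r u(1)] rie u by simp
    also have "\<dots> = Zero C e x"
      using Cmp_assoc[OF H(2,3) h] cross Cmp_Zero_right[OF h] ob by simp
    finally have "h \<odot> pa = Zero C m x"
      using n_epi[OF u(1)] u Cmp_Zero_left[OF r] Hom_Ob[OF h] by simp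
    then have "(h \<odot> pa) \<odot> ia = Zero C a x" using Cmp_Zero_left[OF H(1)] Hom_Ob[OF h] by simp
    then show "h = Zero C a x"
      using Cmp_assoc[OF H(1,3) h] pia Cmp_Idn_right[OF h] by simp
  qed
  have "g \<odot> Zero C b a = p \<odot> i" using S(3) Cmp_Zero_right[OF g] ob by simp
  then obtain j where j: "j \<in> Hom C b w" "pa \<odot> (k \<odot> j) = Zero C b a" "pe \<odot> (k \<odot> j) = i"
    using pullback_lift[OF B g S(2) n wk[unfolded r_def] Zero_Hom[OF ob(3,1)] S(1)] by blast
  have j': "(pa \<odot> k) \<odot> j = Zero C b a" "(pe \<odot> k) \<odot> j = i"
    using j Cmp_assoc[OF j(1) K(1) H(3)] Cmp_assoc[OF j(1) K(1) H(4)] by simp_all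
  have "is_kernel C j (pa \<odot> k)"
    unfolding is_kernel_iff[OF j(1) pk]
  proof (intro conjI ballI impI ex_ex1I)
    show "(pa \<odot> k) \<odot> j = Zero C b a" by (fact j')
    fix y x assume y: "y \<in> Ob C" and x: "x \<in> Hom C y w" and pkx: "(pa \<odot> k) \<odot> x = Zero C y a"
    have "p \<odot> ((pe \<odot> k) \<odot> x) = Zero C y c"
      using Cmp_assoc[OF x ek S(2)] Cmp_assoc[OF x pk g] square pkx Cmp_Zero_right[OF g y] by simp
    then obtain u where u: "u \<in> Hom C y b" "i \<odot> u = (pe \<odot> k) \<odot> x"
      using short_exact_lift[OF s Cmp_Hom[OF x ek]] by blast
    note ju = Cmp_Hom[OF u(1) j(1)]
    have "(pa \<odot> k) \<odot> (j \<odot> u) = (pa \<odot> k) \<odot> x"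
      using Cmp_assoc[OF u(1) j(1) pk] j'(1) Cmp_Zero_left[OF u(1)] pkx ob by simp
    moreover have "(pe \<odot> k) \<odot> (j \<odot> u) = (pe \<odot> k) \<odot> x"
      using Cmp_assoc[OF u(1) j(1) ek] j'(2) u by simp
    ultimately have "k \<odot> (j \<odot> u) = k \<odot> x"
      using biproduct_ext[OF B Cmp_Hom[OF ju K(1)] Cmp_Hom[OF x K(1)]]
        Cmp_assoc[OF ju K(1) H(3)] Cmp_assoc[OF ju K(1) H(4)]
        Cmp_assoc[OF x K(1) H(3)] Cmp_assoc[OF x K(1) H(4)] by simp
    then have "j \<odot> u = x" using short_exact_monic[OF wk ju x] by blast
    then show "\<exists>u. u \<in> Hom C y b \<and> j \<odot> u = x" using u by blast
    fix u v assume "u \<in> Hom C y b \<and> j \<odot> u = x" "v \<in> Hom C y b \<and> j \<odot> v = x"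
    then have uv: "u \<in> Hom C y b" "v \<in> Hom C y b" "j \<odot> u = j \<odot> v" by auto
    then have "i \<odot> u = i \<odot> v"
      using Cmp_assoc[OF uv(1) j(1) ek] Cmp_assoc[OF uv(2) j(1) ek] j'(2) by simp
    then show "u = v" using short_exact_monic[OF s uv(1,2)] by blast
  qed
  then have "short_exact C b j w (pa \<odot> k) a"
    using epi_kernel_short_exact epi j(1) pk by blast
  then show ?thesis using B n wk square unfolding r_def by blast
qed

lemma mono_if_cancels_Zero:
  assumes "m \<in> Hom C b a"
    and "\<And>x h. h \<in> Hom C x b \<Longrightarrow> m \<odot> h = Zero C x a \<Longrightarrow> h = Zero C x b"
  shows "is_mono C m"
  using preadditive_category.epi_if_cancels_Zero[of "opposite C" m a b]
    abelian_category_opposite[OF abelian_category_axioms] assms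
  by (simp add: abelian_category_def)

text \<open>If \<open>e\<close> is an extension of \<open>c\<close> by \<open>b\<close>, and \<open>b'\<close> is a subobject of \<open>b\<close> with quotient \<open>b''\<close>, then
  \<open>e\<^sub>1 = e/b'\<close> is an extension of \<open>c\<close> by \<open>b''\<close>, namely the image of the class of \<open>e\<close> under
  \<open>Ext\<^sup>1(c, b) \<rightarrow> Ext\<^sup>1(c, b'')\<close>. That \<open>b'' \<rightarrow> e\<^sub>1\<close> has the universal property of the kernel follows
  once it is monic, because every monic is a kernel of its cokernel.\<close>

lemma quotient_of_extension:
  assumes s: "short_exact C b i e p c" and s': "short_exact C b' i' b p' b''"
  shows "\<exists>e\<^sub>1 q i\<^sub>1 p\<^sub>1. short_exact C b' (i \<odot> i') e q e\<^sub>1 \<and>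
    short_exact C b'' i\<^sub>1 e\<^sub>1 p\<^sub>1 c \<and> p\<^sub>1 \<odot> q = p"
proof -
  note S = short_exact_Hom[OF s] and S' = short_exact_Hom[OF s']
  note ob = Hom_Ob[OF S(1)] Hom_Ob[OF S(2)] Hom_Ob[OF S'(1)] Hom_Ob[OF S'(2)]
  note ii = Cmp_Hom[OF S'(1) S(1)]
  have mono: "is_mono C (i \<odot> i')"
  proof (rule mono_if_cancels_Zero[OF ii])
    fix x h assume h: "h \<in> Hom C x b'" and "(i \<odot> i') \<odot> h = Zero C x e"
    then have "i \<odot> (i' \<odot> h) = i \<odot> Zero C x b"
      using Cmp_assoc[OF h S'(1) S(1)] Cmp_Zero_right[OF S(1)] Hom_Ob[OF h] by simp
    then have "i' \<odot> h = i' \<odot> Zero C x b'"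
      using short_exact_monic[OF s Cmp_Hom[OF h S'(1)]] Zero_Hom Hom_Ob[OF h] ob
        Cmp_Zero_right[OF S'(1)] by simp
    then show "h = Zero C x b'"
      using short_exact_monic[OF s' h] Zero_Hom Hom_Ob[OF h] by blast
  qed
  obtain q where q: "is_cokernel C q (i \<odot> i')"
    using ex_cokernel ii by (auto simp: Hom_def)
  define e\<^sub>1 where "e\<^sub>1 = Cod C q"
  have qH: "q \<in> Hom C e e\<^sub>1" using q ii by (auto simp: is_cokernel_def Hom_def e\<^sub>1_def)
  have sq: "short_exact C b' (i \<odot> i') e q e\<^sub>1"
    using mono_cokernel_short_exact[OF mono q ii qH] .
  note Q = short_exact_Hom[OF sq]
  note ob1 = Hom_Ob[OF qH]
  have "(q \<odot> i) \<odot> i' = Zero C b' e\<^sub>1" using Cmp_assoc[OF S'(1) S(1) qH] Q(3) by simp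
  then obtain i\<^sub>1 where i\<^sub>1: "i\<^sub>1 \<in> Hom C b'' e\<^sub>1" "i\<^sub>1 \<odot> p' = q \<odot> i"
    using short_exact_colift[OF s' Cmp_Hom[OF S(1) qH]] by blast
  have "p \<odot> (i \<odot> i') = Zero C b' c"
    using Cmp_assoc[OF S'(1) S(1,2)] S(3) Cmp_Zero_left[OF S'(1)] ob by simp
  then obtain p\<^sub>1 where p\<^sub>1: "p\<^sub>1 \<in> Hom C e\<^sub>1 c" "p\<^sub>1 \<odot> q = p"
    using short_exact_colift[OF sq S(2)] by blast
  have "is_mono C i\<^sub>1"
  proof (rule mono_if_cancels_Zero[OF i\<^sub>1(1)])
    fix x h assume h: "h \<in> Hom C x b''" and ih: "i\<^sub>1 \<odot> h = Zero C x e\<^sub>1"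
    note obx = Hom_Ob[OF h]
    \<comment> \<open>Without elements, \<open>h\<close> is lifted to \<open>b\<close> after passing to an epi \<open>r\<close> onto its domain.\<close>
    obtain w j r y where r: "short_exact C b' j w r x" and y: "y \<in> Hom C w b" "h \<odot> r = p' \<odot> y"
    proof -
      obtain m ia ie pa pe n w k j where *: "biproduct C x b m ia ie pa pe"
        "short_exact C w k m ((h \<odot> pa) \<boxplus> (n \<odot> pe)) b''"
        "short_exact C b' j w (pa \<odot> k) x" "h \<odot> (pa \<odot> k) = p' \<odot> (pe \<odot> k)"
        using ex_pullback[OF s' h] by blast
      have "pe \<odot> k \<in> Hom C w b"
        using Cmp_Hom short_exact_Hom(1)[OF *(2)] *(1) by (auto simp: biproduct_def)
      then show thesis using that * by blast
    qed
    note R = short_exact_Hom[OF r]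
    have "q \<odot> (i \<odot> y) = (q \<odot> i) \<odot> y" using Cmp_assoc[OF y(1) S(1) qH] by simp
    also have "\<dots> = (i\<^sub>1 \<odot> h) \<odot> r"
      using i\<^sub>1 y Cmp_assoc[OF y(1) S'(2) i\<^sub>1(1)] Cmp_assoc[OF R(2) h i\<^sub>1(1)] by simp
    also have "\<dots> = Zero C w e\<^sub>1" using ih Cmp_Zero_left[OF R(2)] ob1 by simp
    finally obtain z where z: "z \<in> Hom C w b'" "(i \<odot> i') \<odot> z = i \<odot> y"
      using short_exact_lift[OF sq Cmp_Hom[OF y(1) S(1)]] by blast
    have "i' \<odot> z = y"
      using short_exact_monic[OF s Cmp_Hom[OF z(1) S'(1)] y(1)] z Cmp_assoc[OF z(1) S'(1) S(1)]
      by simp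
    then have "h \<odot> r = Zero C x b'' \<odot> r"
      using y Cmp_assoc[OF z(1) S'(1,2)] S'(3) Cmp_Zero_left[OF z(1)] Cmp_Zero_left[OF R(2)] obx
      by simp
    then show "h = Zero C x b''"
      using short_exact_epic[OF r h] Zero_Hom obx by blast
  qed
  moreover have "is_cokernel C p\<^sub>1 i\<^sub>1"
    unfolding is_cokernel_iff[OF p\<^sub>1(1) i\<^sub>1(1)]
  proof (intro conjI ballI impI ex_ex1I)
    have "(p\<^sub>1 \<odot> i\<^sub>1) \<odot> p' = Zero C b'' c \<odot> p'"
      using Cmp_assoc[OF S'(2) i\<^sub>1(1) p\<^sub>1(1)] i\<^sub>1(2) Cmp_assoc[OF S(1) qH p\<^sub>1(1)] p\<^sub>1(2) S(3)
        Cmp_Zero_left[OF S'(2)] ob by simp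
    then show "p\<^sub>1 \<odot> i\<^sub>1 = Zero C b'' c"
      using short_exact_epic[OF s' Cmp_Hom[OF i\<^sub>1(1) p\<^sub>1(1)]] Zero_Hom ob by blast
    fix x g assume x: "x \<in> Ob C" and g: "g \<in> Hom C e\<^sub>1 x" and gi: "g \<odot> i\<^sub>1 = Zero C b'' x"
    have "(g \<odot> q) \<odot> i = Zero C b x"
      using Cmp_assoc[OF S(1) qH g] i\<^sub>1(2) Cmp_assoc[OF S'(2) i\<^sub>1(1) g] gi
        Cmp_Zero_left[OF S'(2) x] by simp
    then obtain u where u: "u \<in> Hom C c x" "u \<odot> p = g \<odot> q"
      using short_exact_colift[OF s Cmp_Hom[OF qH g]] by blast
    then have "(u \<odot> p\<^sub>1) \<odot> q = g \<odot> q" using Cmp_assoc[OF qH p\<^sub>1(1) u(1)] p\<^sub>1(2) by simp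
    then have "u \<odot> p\<^sub>1 = g" using short_exact_epic[OF sq Cmp_Hom[OF p\<^sub>1(1) u(1)] g] by blast
    then show "\<exists>u. u \<in> Hom C c x \<and> u \<odot> p\<^sub>1 = g" using u by blast
    fix u v assume "u \<in> Hom C c x \<and> u \<odot> p\<^sub>1 = g" "v \<in> Hom C c x \<and> v \<odot> p\<^sub>1 = g"
    then have uv: "u \<in> Hom C c x" "v \<in> Hom C c x" "u \<odot> p\<^sub>1 = v \<odot> p\<^sub>1" by auto
    then have "u \<odot> p = v \<odot> p"
      using Cmp_assoc[OF qH p\<^sub>1(1) uv(1)] Cmp_assoc[OF qH p\<^sub>1(1) uv(2)] p\<^sub>1(2) by simp
    then show "u = v" using short_exact_epic[OF s uv(1,2)] by blast
  qed
  ultimately have "short_exact C b'' i\<^sub>1 e\<^sub>1 p\<^sub>1 c"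
    using mono_cokernel_short_exact i\<^sub>1(1) p\<^sub>1(1) by blast
  then show ?thesis using sq p\<^sub>1 by blast
qed

end


text \<open>The retraction is the difference of the identity and \<open>t \<odot> p\<close>, which vanishes under \<open>p\<close> and
  hence factors through \<open>i\<close>.\<close>

lemma (in abelian_category) retraction_if_section:
  assumes s: "short_exact C b i e p a" and t: "t \<in> Hom C a e" "p \<odot> t = Idn C a"
  shows "\<exists>r \<in> Hom C e b. r \<odot> i = Idn C b"
proof -
  note S = short_exact_Hom[OF s]
  note ob = Hom_Ob[OF S(1)] Hom_Ob[OF S(2)]
  note tp = Cmp_Hom[OF S(2) t(1)]
  have "p \<odot> Idn C e = p \<odot> (t \<odot> p)"
    using Cmp_assoc[OF S(2) t(1) S(2)] t(2) Cmp_Idn_left[OF S(2)] Cmp_Idn_right[OF S(2)] by simp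
  then obtain d where d: "d \<in> Hom C e b" "Idn C e = (t \<odot> p) \<boxplus> (i \<odot> d)"
    using short_exact_diff[OF s Idn_Hom tp] ob by blast
  note di = Cmp_Hom[OF S(1) d(1)]
  have "i = ((t \<odot> p) \<boxplus> (i \<odot> d)) \<odot> i" using d(2) Cmp_Idn_left[OF S(1)] by simp
  also have "\<dots> = (t \<odot> p) \<odot> i \<boxplus> i \<odot> (d \<odot> i)"
    using Cmp_Add_left[OF S(1) tp Cmp_Hom[OF d(1) S(1)]] Cmp_assoc[OF S(1) d(1) S(1)] by simp
  also have "(t \<odot> p) \<odot> i = Zero C b e"
    using Cmp_assoc[OF S(1,2) t(1)] S(3) Cmp_Zero_right[OF t(1)] ob by simp
  also have "Zero C b e \<boxplus> i \<odot> (d \<odot> i) = i \<odot> (d \<odot> i)"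
    using Add_Zero(2)[OF Cmp_Hom[OF di S(1)]] .
  finally have "i \<odot> (d \<odot> i) = i \<odot> Idn C b" using Cmp_Idn_right[OF S(1)] by simp
  then have "d \<odot> i = Idn C b"
    using short_exact_monic[OF s di Idn_Hom] ob by blast
  then show ?thesis using d by blast
qed

text \<open>This makes splitting, and with it \<open>ext1_injective\<close> below, a self-dual notion.\<close>

lemma (in abelian_category) section_iff_retraction:
  assumes s: "short_exact C b i e p a"
  shows "(\<exists>t \<in> Hom C a e. p \<odot> t = Idn C a) \<longleftrightarrow> (\<exists>r \<in> Hom C e b. r \<odot> i = Idn C b)"
  using retraction_if_section[OF s]
    abelian_category.retraction_if_section[OF abelian_category_opposite[OF abelian_category_axioms],
      of a p e i b] s by auto

section \<open>Exact functors and extensions\<close>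

text \<open>For an exact functor \<open>F\<close> the induced map from \<open>Ext\<^sup>1(a, b)\<close> to \<open>Ext\<^sup>1(F a, F b)\<close> is additive, so its
  injectivity means that only split extensions become split.\<close>

definition ext1_injective ::
    "('o, 'm, 'x) preadd_cat_scheme \<Rightarrow> ('p, 'n, 'y) preadd_cat_scheme \<Rightarrow>
      ('o, 'm, 'p, 'n) cat_functor \<Rightarrow> 'o \<Rightarrow> 'o \<Rightarrow> bool"
  where "ext1_injective C D F a b \<longleftrightarrow> (\<forall>i e p. short_exact C b i e p a \<longrightarrow>
    (\<exists>s \<in> Hom D (FOb F a) (FOb F e). FAr F p \<odot>\<^bsub>D\<^esub> s = Idn D (FOb F a)) \<longrightarrow>
    (\<exists>s \<in> Hom C a e. p \<odot>\<^bsub>C\<^esub> s = Idn C a))"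

definition hom_iso_ext1_injective ::
    "('o, 'm, 'x) preadd_cat_scheme \<Rightarrow> ('p, 'n, 'y) preadd_cat_scheme \<Rightarrow>
      ('o, 'm, 'p, 'n) cat_functor \<Rightarrow> 'o \<Rightarrow> 'o \<Rightarrow> bool"
  where "hom_iso_ext1_injective C D F a b \<longleftrightarrow>
    bij_betw (FAr F) (Hom C a b) (Hom D (FOb F a) (FOb F b)) \<and> ext1_injective C D F a b"

locale abelian_exact_functor = exact_functor C D F + dom: abelian_category C + cod: abelian_category D
  for C :: "('o, 'm, 'x) preadd_cat_scheme" and D :: "('p, 'n, 'y) preadd_cat_scheme"
    and F :: "('o, 'm, 'p, 'n) cat_functor"
begin

lemma FAr_Zero:
  assumes "a \<in> Ob C" "b \<in> Ob C"
  shows "FAr F (Zero C a b) = Zero D (FOb F a) (FOb F b)"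
proof -
  have z: "Zero C a b \<in> Hom C a b" using dom.Zero_Hom assms by blast
  have "FAr F (Zero C a b) \<boxplus>\<^bsub>D\<^esub> FAr F (Zero C a b) = FAr F (Zero C a b)"
    using FAr_Add[OF z z] dom.Add_Zero(1)[OF z] by simp
  then show ?thesis using cod.Add_eq_left_Zero FAr_Hom[OF z] by blast
qed

lemma abelian_exact_functor_opposite: "abelian_exact_functor (opposite C) (opposite D) F"
proof -
  have "abelian_category (opposite C)" "abelian_category (opposite D)"
    using abelian_category_opposite dom.abelian_category_axioms cod.abelian_category_axioms
    by blast+
  then show ?thesis
    using FOb_closed FAr_Hom FAr_Idn FAr_Cmp FAr_Add short_exact_preserved
    by (simp add: abelian_exact_functor_def exact_functor_def is_functor_def
        is_functor_axioms_def exact_functor_axioms_def abelian_category_def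
        preadditive_category_def)
qed

lemma biproduct_preserved:
  assumes "biproduct C a b m i j p q"
  shows "biproduct D (FOb F a) (FOb F b) (FOb F m) (FAr F i) (FAr F j) (FAr F p) (FAr F q)"
proof -
  have H: "i \<in> Hom C a m" "j \<in> Hom C b m" "p \<in> Hom C m a" "q \<in> Hom C m b"
    and E: "p \<odot>\<^bsub>C\<^esub> i = Idn C a" "q \<odot>\<^bsub>C\<^esub> j = Idn C b"
      "(i \<odot>\<^bsub>C\<^esub> p) \<boxplus>\<^bsub>C\<^esub> (j \<odot>\<^bsub>C\<^esub> q) = Idn C m"
    using assms by (auto simp: biproduct_def)
  note ob = dom.Hom_Ob[OF H(3)] dom.Hom_Ob[OF H(4)]
  show ?thesis
    using FAr_Cmp[OF H(1,3)] FAr_Cmp[OF H(3,1)] FAr_Cmp[OF H(2,4)] FAr_Cmp[OF H(4,2)]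
      FAr_Add[OF dom.Cmp_Hom[OF H(3,1)] dom.Cmp_Hom[OF H(4,2)]] E FAr_Idn ob H FAr_Hom
    by (simp add: biproduct_def)
qed

text \<open>The obstruction to lifting \<open>g : a \<rightarrow> c\<close> through \<open>p : e \<rightarrow> c\<close> is the class in \<open>Ext\<^sup>1(a, b)\<close> of the
  pullback of \<open>e\<close> along \<open>g\<close>. If the image of \<open>g\<close> lifts, then the image of the pullback splits, so
  the pullback itself splits.\<close>

lemma ext1_injective_lift:
  assumes inj: "ext1_injective C D F a b" and s: "short_exact C b i e p c"
    and g: "g \<in> Hom C a c"
    and t: "t \<in> Hom D (FOb F a) (FOb F e)" "FAr F p \<odot>\<^bsub>D\<^esub> t = FAr F g"
  shows "\<exists>u \<in> Hom C a e. p \<odot>\<^bsub>C\<^esub> u = g"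
proof -
  note S = dom.short_exact_Hom[OF s]
  obtain m ia ie pa pe n w k j where B: "biproduct C a e m ia ie pa pe"
    and n: "n \<in> Hom C e c" "p \<boxplus>\<^bsub>C\<^esub> n = Zero C e c"
    and wk: "short_exact C w k m ((g \<odot>\<^bsub>C\<^esub> pa) \<boxplus>\<^bsub>C\<^esub> (n \<odot>\<^bsub>C\<^esub> pe)) c"
    and w: "short_exact C b j w (pa \<odot>\<^bsub>C\<^esub> k) a"
    and square: "g \<odot>\<^bsub>C\<^esub> (pa \<odot>\<^bsub>C\<^esub> k) = p \<odot>\<^bsub>C\<^esub> (pe \<odot>\<^bsub>C\<^esub> k)"
    using dom.ex_pullback[OF s g] by blast
  have P: "pa \<in> Hom C m a" "pe \<in> Hom C m e" using B by (auto simp: biproduct_def)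
  note K = dom.short_exact_Hom[OF wk] and W = dom.short_exact_Hom[OF w]
  note ob = dom.Hom_Ob[OF g] dom.Hom_Ob[OF S(1)]
  note ek = dom.Cmp_Hom[OF K(1) P(2)]
  have "FAr F p \<boxplus>\<^bsub>D\<^esub> FAr F n = Zero D (FOb F e) (FOb F c)"
    using FAr_Add[OF S(2) n(1)] n(2) FAr_Zero ob by simp
  moreover have "short_exact D (FOb F w) (FAr F k) (FOb F m)
      ((FAr F g \<odot>\<^bsub>D\<^esub> FAr F pa) \<boxplus>\<^bsub>D\<^esub> (FAr F n \<odot>\<^bsub>D\<^esub> FAr F pe)) (FOb F c)"
    using short_exact_preserved[OF wk] FAr_Cmp[OF P(1) g] FAr_Cmp[OF P(2) n(1)]
      FAr_Add[OF dom.Cmp_Hom[OF P(1) g] dom.Cmp_Hom[OF P(2) n(1)]] by simp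
  moreover have "FAr F g \<odot>\<^bsub>D\<^esub> Idn D (FOb F a) = FAr F p \<odot>\<^bsub>D\<^esub> t"
    using cod.Cmp_Idn_right[OF FAr_Hom[OF g]] t by simp
  ultimately obtain v where v: "v \<in> Hom D (FOb F a) (FOb F w)"
      "FAr F pa \<odot>\<^bsub>D\<^esub> (FAr F k \<odot>\<^bsub>D\<^esub> v) = Idn D (FOb F a)"
    using cod.pullback_lift[OF biproduct_preserved[OF B] FAr_Hom[OF g] FAr_Hom[OF S(2)]
        FAr_Hom[OF n(1)] _ _ cod.Idn_Hom[OF FOb_closed[OF ob(1)]] t(1)] by blast
  have "FAr F (pa \<odot>\<^bsub>C\<^esub> k) \<odot>\<^bsub>D\<^esub> v = Idn D (FOb F a)"
    using FAr_Cmp[OF K(1) P(1)] v cod.Cmp_assoc[OF v(1) FAr_Hom[OF K(1)] FAr_Hom[OF P(1)]] by simp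
  then obtain x where x: "x \<in> Hom C a w" "(pa \<odot>\<^bsub>C\<^esub> k) \<odot>\<^bsub>C\<^esub> x = Idn C a"
    using inj w v(1) unfolding ext1_injective_def by blast
  have "p \<odot>\<^bsub>C\<^esub> ((pe \<odot>\<^bsub>C\<^esub> k) \<odot>\<^bsub>C\<^esub> x) = g"
    using dom.Cmp_assoc[OF x(1) ek S(2)] dom.Cmp_assoc[OF x(1) W(2) g] square x(2)
      dom.Cmp_Idn_right[OF g] by simp
  then show ?thesis using dom.Cmp_Hom[OF x(1) ek] by blast
qed

text \<open>The five lemma in the second argument: surjectivity on \<open>Hom(a, b)\<close> uses injectivity on
  \<open>Ext\<^sup>1(a, b')\<close>, and injectivity on \<open>Ext\<^sup>1(a, b)\<close> uses surjectivity on \<open>Hom(a, b'')\<close>, where the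
  connecting homomorphism to \<open>Ext\<^sup>1(a, b')\<close> starts.\<close>

lemma hom_iso_ext1_injective_extension_right:
  assumes good': "hom_iso_ext1_injective C D F a b'"
    and good'': "hom_iso_ext1_injective C D F a b''"
    and s: "short_exact C b' i b p b''" and a: "a \<in> Ob C"
  shows "hom_iso_ext1_injective C D F a b"
proof -
  note S = dom.short_exact_Hom[OF s]
  note Fs = short_exact_preserved[OF s]
  note ob = dom.Hom_Ob[OF S(1)] dom.Hom_Ob[OF S(2)]
  have inj': "u = v" if "u \<in> Hom C a b'" "v \<in> Hom C a b'" "FAr F u = FAr F v" for u v
    using good' that by (auto simp: hom_iso_ext1_injective_def bij_betw_def inj_on_def)
  have inj'': "u = v" if "u \<in> Hom C a b''" "v \<in> Hom C a b''" "FAr F u = FAr F v" for u v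
    using good'' that by (auto simp: hom_iso_ext1_injective_def bij_betw_def inj_on_def)
  have full': "\<exists>u \<in> Hom C a b'. FAr F u = v" if "v \<in> Hom D (FOb F a) (FOb F b')" for v
    using good' that
    unfolding hom_iso_ext1_injective_def bij_betw_def by (metis imageE)
  have full'': "\<exists>u \<in> Hom C a b''. FAr F u = v" if "v \<in> Hom D (FOb F a) (FOb F b'')" for v
    using good'' that
    unfolding hom_iso_ext1_injective_def bij_betw_def by (metis imageE)
  have ext': "ext1_injective C D F a b'" and ext'': "ext1_injective C D F a b''"
    using good' good'' by (simp_all add: hom_iso_ext1_injective_def)
  have "inj_on (FAr F) (Hom C a b)"
  proof (rule inj_onI)
    fix f g assume f: "f \<in> Hom C a b" and g: "g \<in> Hom C a b" and eq: "FAr F f = FAr F g"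
    have "FAr F (p \<odot>\<^bsub>C\<^esub> f) = FAr F (p \<odot>\<^bsub>C\<^esub> g)" using FAr_Cmp f g S(2) eq by simp
    then have "p \<odot>\<^bsub>C\<^esub> f = p \<odot>\<^bsub>C\<^esub> g" using inj'' dom.Cmp_Hom f g S(2) by blast
    then obtain d where d: "d \<in> Hom C a b'" "f = g \<boxplus>\<^bsub>C\<^esub> (i \<odot>\<^bsub>C\<^esub> d)"
      using dom.short_exact_diff[OF s f g] by blast
    note id = dom.Cmp_Hom[OF d(1) S(1)]
    have "FAr F g \<boxplus>\<^bsub>D\<^esub> FAr F (i \<odot>\<^bsub>C\<^esub> d) = FAr F g"
      using FAr_Add[OF g id] d(2) eq by simp
    then have "FAr F i \<odot>\<^bsub>D\<^esub> FAr F d = FAr F i \<odot>\<^bsub>D\<^esub> FAr F (Zero C a b')"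
      using cod.Add_eq_left_Zero[OF FAr_Hom[OF g] FAr_Hom[OF id]] FAr_Cmp[OF d(1) S(1)]
        FAr_Zero[OF a ob(1)] cod.Cmp_Zero_right[OF FAr_Hom[OF S(1)] FOb_closed[OF a]] by simp
    then have "FAr F d = FAr F (Zero C a b')"
      using cod.short_exact_monic[OF Fs] FAr_Hom d(1) dom.Zero_Hom[OF a ob(1)] by blast
    then have "d = Zero C a b'" using inj' d(1) dom.Zero_Hom[OF a ob(1)] by blast
    then show "f = g"
      using d(2) dom.Cmp_Zero_right[OF S(1) a] dom.Add_Zero(1)[OF g] by simp
  qed
  moreover have "v \<in> FAr F ` Hom C a b" if v: "v \<in> Hom D (FOb F a) (FOb F b)" for v
  proof -
    obtain g where g: "g \<in> Hom C a b''" "FAr F g = FAr F p \<odot>\<^bsub>D\<^esub> v"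
      using full'' cod.Cmp_Hom[OF v FAr_Hom[OF S(2)]] by blast
    then obtain t where t: "t \<in> Hom C a b" "p \<odot>\<^bsub>C\<^esub> t = g"
      using ext1_injective_lift[OF ext' s g(1) v] by auto
    have "FAr F p \<odot>\<^bsub>D\<^esub> v = FAr F p \<odot>\<^bsub>D\<^esub> FAr F t" using FAr_Cmp[OF t(1) S(2)] t g by simp
    then obtain d where d: "d \<in> Hom D (FOb F a) (FOb F b')" "v = FAr F t \<boxplus>\<^bsub>D\<^esub> (FAr F i \<odot>\<^bsub>D\<^esub> d)"
      using cod.short_exact_diff[OF Fs v FAr_Hom[OF t(1)]] by blast
    obtain d' where d': "d' \<in> Hom C a b'" "FAr F d' = d" using full' d by blast
    have "FAr F (t \<boxplus>\<^bsub>C\<^esub> (i \<odot>\<^bsub>C\<^esub> d')) = v"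
      using FAr_Add[OF t(1) dom.Cmp_Hom[OF d'(1) S(1)]] FAr_Cmp[OF d'(1) S(1)] d d' by simp
    then show ?thesis using dom.Add_Hom[OF t(1) dom.Cmp_Hom[OF d'(1) S(1)]] by blast
  qed
  then have "FAr F ` Hom C a b = Hom D (FOb F a) (FOb F b)" using FAr_Hom by blast
  moreover have "ext1_injective C D F a b"
    unfolding ext1_injective_def
  proof (intro allI impI)
    fix j e q assume e: "short_exact C b j e q a"
      and "\<exists>s \<in> Hom D (FOb F a) (FOb F e). FAr F q \<odot>\<^bsub>D\<^esub> s = Idn D (FOb F a)"
    then obtain t where t: "t \<in> Hom D (FOb F a) (FOb F e)" "FAr F q \<odot>\<^bsub>D\<^esub> t = Idn D (FOb F a)"
      by blast
    note E = dom.short_exact_Hom[OF e]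
    \<comment> \<open>First split the quotient \<open>e\<^sub>1 = e/b'\<close>, an extension of \<open>a\<close> by \<open>b''\<close>, then lift the section to \<open>e\<close>.\<close>
    obtain e\<^sub>1 r j\<^sub>1 q\<^sub>1 where r: "short_exact C b' (j \<odot>\<^bsub>C\<^esub> i) e r e\<^sub>1"
      and e\<^sub>1: "short_exact C b'' j\<^sub>1 e\<^sub>1 q\<^sub>1 a" and qr: "q\<^sub>1 \<odot>\<^bsub>C\<^esub> r = q"
      using dom.quotient_of_extension[OF e s] by blast
    note R = dom.short_exact_Hom[OF r] and E1 = dom.short_exact_Hom[OF e\<^sub>1]
    note rt = cod.Cmp_Hom[OF t(1) FAr_Hom[OF R(2)]]
    have sec: "FAr F q\<^sub>1 \<odot>\<^bsub>D\<^esub> (FAr F r \<odot>\<^bsub>D\<^esub> t) = Idn D (FOb F a)"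
      using cod.Cmp_assoc[OF t(1) FAr_Hom[OF R(2)] FAr_Hom[OF E1(2)]] FAr_Cmp[OF R(2) E1(2)] qr t
      by simp
    then obtain u where u: "u \<in> Hom C a e\<^sub>1" "q\<^sub>1 \<odot>\<^bsub>C\<^esub> u = Idn C a"
      using ext'' e\<^sub>1 rt unfolding ext1_injective_def by blast
    \<comment> \<open>The image of the section \<open>u\<close> need not be the one induced by \<open>t\<close>, and only the latter is known
      to lift to the image of \<open>e\<close>. Both are sections, so they differ by an arrow into the image of
      \<open>b''\<close>; by fullness it comes from an arrow \<open>a \<rightarrow> b''\<close>, which corrects \<open>u\<close> to \<open>u'\<close>.\<close>
    have "FAr F q\<^sub>1 \<odot>\<^bsub>D\<^esub> (FAr F r \<odot>\<^bsub>D\<^esub> t) = FAr F q\<^sub>1 \<odot>\<^bsub>D\<^esub> FAr F u"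
      using sec FAr_Cmp[OF u(1) E1(2)] u(2) FAr_Idn[OF a] by simp
    then obtain d where d: "d \<in> Hom D (FOb F a) (FOb F b'')"
        "FAr F r \<odot>\<^bsub>D\<^esub> t = FAr F u \<boxplus>\<^bsub>D\<^esub> (FAr F j\<^sub>1 \<odot>\<^bsub>D\<^esub> d)"
      using cod.short_exact_diff[OF short_exact_preserved[OF e\<^sub>1] rt FAr_Hom[OF u(1)]] by blast
    obtain d' where d': "d' \<in> Hom C a b''" "FAr F d' = d" using full'' d by blast
    note jd = dom.Cmp_Hom[OF d'(1) E1(1)]
    define u' where "u' = u \<boxplus>\<^bsub>C\<^esub> (j\<^sub>1 \<odot>\<^bsub>C\<^esub> d')"
    have u': "u' \<in> Hom C a e\<^sub>1" unfolding u'_def using dom.Add_Hom[OF u(1) jd] .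
    have "FAr F r \<odot>\<^bsub>D\<^esub> t = FAr F u'"
      unfolding u'_def using FAr_Add[OF u(1) jd] FAr_Cmp[OF d'(1) E1(1)] d d' by simp
    then obtain x where x: "x \<in> Hom C a e" "r \<odot>\<^bsub>C\<^esub> x = u'"
      using ext1_injective_lift[OF ext' r u' t(1)] by blast
    have "q\<^sub>1 \<odot>\<^bsub>C\<^esub> (j\<^sub>1 \<odot>\<^bsub>C\<^esub> d') = Zero C a a"
      using dom.Cmp_assoc[OF d'(1) E1(1,2)] E1(3) dom.Cmp_Zero_left[OF d'(1) a] by simp
    then have "q\<^sub>1 \<odot>\<^bsub>C\<^esub> u' = Idn C a"
      unfolding u'_def using dom.Cmp_Add_right[OF u(1) jd E1(2)] u(2)
        dom.Add_Zero(1)[OF dom.Idn_Hom[OF a]] by simp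
    then have "q \<odot>\<^bsub>C\<^esub> x = Idn C a" using dom.Cmp_assoc[OF x(1) R(2) E1(2)] qr x by simp
    then show "\<exists>s\<in>Hom C a e. q \<odot>\<^bsub>C\<^esub> s = Idn C a" using x by blast
  qed
  ultimately show ?thesis by (simp add: hom_iso_ext1_injective_def bij_betw_def)
qed

lemma hom_iso_ext1_injective_opposite:
  "hom_iso_ext1_injective (opposite C) (opposite D) F b a \<longleftrightarrow> hom_iso_ext1_injective C D F a b"
proof -
  have "ext1_injective (opposite C) (opposite D) F b a \<longleftrightarrow> ext1_injective C D F a b"
    unfolding ext1_injective_def
    using dom.section_iff_retraction[of b _ _ _ a]
      cod.section_iff_retraction[OF short_exact_preserved[of b _ _ _ a]]
    by simp meson
  then show ?thesis by (simp add: hom_iso_ext1_injective_def)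
qed

lemma hom_iso_ext1_injective_extension_left:
  assumes "hom_iso_ext1_injective C D F a' b" "hom_iso_ext1_injective C D F a'' b"
    and "short_exact C a' i a p a''" and "b \<in> Ob C"
  shows "hom_iso_ext1_injective C D F a b"
  using abelian_exact_functor.hom_iso_ext1_injective_extension_right[OF
      abelian_exact_functor_opposite, of b a'' a' p a i] assms
  by (simp add: hom_iso_ext1_injective_opposite)

lemma hom_iso_ext1_injective_Exk_right:
  assumes "\<And>b. b \<in> S \<Longrightarrow> hom_iso_ext1_injective C D F a b" and "a \<in> Ob C" and "b \<in> Exk C S k"
  shows "hom_iso_ext1_injective C D F a b"
  using assms(3)
proof (induction k arbitrary: b)
  case (Suc k)
  then obtain x y i p where "x \<in> S" "y \<in> Exk C S k" "short_exact C x i b p y"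
    by (auto simp: ext_star_def)
  then show ?case
    using hom_iso_ext1_injective_extension_right assms(1,2) Suc.IH by blast
qed (use assms in simp)

lemma hom_iso_ext1_injective_Exk_left:
  assumes "\<And>a. a \<in> S \<Longrightarrow> hom_iso_ext1_injective C D F a b" and "b \<in> Ob C" and "a \<in> Exk C S k"
  shows "hom_iso_ext1_injective C D F a b"
  using assms(3)
proof (induction k arbitrary: a)
  case (Suc k)
  then obtain x y i p where "x \<in> S" "y \<in> Exk C S k" "short_exact C x i a p y"
    by (auto simp: ext_star_def)
  then show ?case
    using hom_iso_ext1_injective_extension_left assms(1,2) Suc.IH by blast
qed (use assms in simp)

text \<open>A splitting of the image of an extension \<open>e\<close> of \<open>a\<close> by \<open>b\<close> is an arrow between images of objects
  of the first neighbourhood, so fullness lifts it, and faithfulness on \<open>Hom(a, a)\<close> shows that the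
  lift is a section.\<close>

lemma hom_iso_ext1_injective_if_neighbourhood:
  assumes hom: "\<And>x y. x \<in> ext_star C S S \<Longrightarrow> y \<in> ext_star C S S \<Longrightarrow>
      bij_betw (FAr F) (Hom C x y) (Hom D (FOb F x) (FOb F y))"
    and sub: "S \<subseteq> ext_star C S S" and a: "a \<in> S" and b: "b \<in> S"
  shows "hom_iso_ext1_injective C D F a b"
  unfolding hom_iso_ext1_injective_def ext1_injective_def
proof (intro conjI allI impI)
  show "bij_betw (FAr F) (Hom C a b) (Hom D (FOb F a) (FOb F b))" using hom sub a b by blast
  fix i e p assume s: "short_exact C b i e p a"
    and "\<exists>s\<in>Hom D (FOb F a) (FOb F e). FAr F p \<odot>\<^bsub>D\<^esub> s = Idn D (FOb F a)"
  then obtain t where t: "t \<in> Hom D (FOb F a) (FOb F e)" "FAr F p \<odot>\<^bsub>D\<^esub> t = Idn D (FOb F a)"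
    by blast
  note S = dom.short_exact_Hom[OF s]
  note ob = dom.Hom_Ob[OF S(2)]
  have "e \<in> ext_star C S S" using s a b ob by (auto simp: ext_star_def)
  then have "t \<in> FAr F ` Hom C a e" using hom[of a e] sub a t(1) by (auto simp: bij_betw_def)
  then obtain u where u: "u \<in> Hom C a e" "FAr F u = t" by blast
  have "FAr F (p \<odot>\<^bsub>C\<^esub> u) = FAr F (Idn C a)" using FAr_Cmp[OF u(1) S(2)] u t FAr_Idn ob by simp
  moreover have "inj_on (FAr F) (Hom C a a)" using hom[of a a] sub a by (auto simp: bij_betw_def)
  ultimately have "p \<odot>\<^bsub>C\<^esub> u = Idn C a"
    using dom.Cmp_Hom[OF u(1) S(2)] dom.Idn_Hom[OF ob(2)] by (auto simp: inj_on_def)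
  then show "\<exists>s\<in>Hom C a e. p \<odot>\<^bsub>C\<^esub> s = Idn C a" using u by blast
qed

end

section \<open>The generating subcategory\<close>

context abelian_category
begin

lemma subobject_of_null_isomorphic:
  assumes s: "short_exact C b i z p c" and z: "is_null C z"
  shows "isomorphic C z b"
proof -
  note S = short_exact_Hom[OF s]
  note ob = Hom_Ob[OF S(1)]
  obtain j where j: "j \<in> Hom C z b" using z ob by (auto simp: is_null_def)
  note ij = Cmp_Hom[OF j S(1)] and ji = Cmp_Hom[OF S(1) j]
  have "i \<odot> j = Idn C z" using z ob ij Idn_Hom[OF ob(2)] unfolding is_null_def by blast
  moreover have "i \<odot> (j \<odot> i) = i \<odot> Idn C b"
    using z ob Cmp_Hom[OF ji S(1)] Cmp_Hom[OF Idn_Hom[OF ob(1)] S(1)] unfolding is_null_def by blast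
  then have "j \<odot> i = Idn C b" using short_exact_monic[OF s ji Idn_Hom[OF ob(1)]] by blast
  ultimately show ?thesis using j S(1) unfolding isomorphic_def by blast
qed

lemma short_exact_Idn_null:
  assumes a: "a \<in> Ob C" and z: "is_null C z"
  shows "\<exists>p. short_exact C a (Idn C a) a p z"
proof -
  have zOb: "z \<in> Ob C" using z by (simp add: is_null_def)
  let ?p = "Zero C a z"
  note p = Zero_Hom[OF a zOb] and id = Idn_Hom[OF a]
  have "is_kernel C (Idn C a) ?p"
    unfolding is_kernel_iff[OF id p]
    using Cmp_Idn_right[OF p] Cmp_Idn_left by auto
  moreover have "is_cokernel C ?p (Idn C a)"
    unfolding is_cokernel_iff[OF p id]
  proof (intro conjI ballI impI)
    show "?p \<odot> Idn C a = Zero C a z" using Cmp_Idn_right[OF p] .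
    fix x g assume x: "x \<in> Ob C" and g: "g \<in> Hom C a x" and "g \<odot> Idn C a = Zero C a x"
    then have "g = Zero C a x" using Cmp_Idn_right[OF g] by simp
    moreover have "Zero C z x \<odot> ?p = Zero C a x" using Cmp_Zero_left[OF p x] .
    ultimately show "\<exists>!u. u \<in> Hom C z x \<and> u \<odot> ?p = g"
      using z x Zero_Hom[OF zOb x] unfolding is_null_def by metis
  qed
  ultimately show ?thesis using p id unfolding short_exact_def by blast
qed

text \<open>A null object lies in some \<open>Exk C S k\<close>, hence, for \<open>k > 0\<close>, has a subobject in \<open>S\<close>; but a
  subobject of a null object is isomorphic to it.\<close>

lemma generating_contains_null:
  assumes S: "strictly_full C S" and gen: "extension_generated C S"
  shows "\<exists>z \<in> S. is_null C z"
proof -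
  obtain z where z: "is_null C z" using ex_null by blast
  then obtain k where k: "z \<in> Exk C S k"
    using gen by (auto simp: extension_generated_def is_null_def)
  have "z \<in> S"
  proof (cases k)
    case (Suc l)
    then obtain b i p c where b: "b \<in> S" and s: "short_exact C b i z p c"
      using k by (auto simp: ext_star_def)
    have "isomorphic C b z"
      using subobject_of_null_isomorphic[OF s z] unfolding isomorphic_def by blast
    then show ?thesis using S b z by (auto simp: strictly_full_def is_null_def)
  qed (use k in simp)
  then show ?thesis using z by blast
qed

text \<open>Every \<open>a \<in> S\<close> is the extension \<open>0 \<rightarrow> a \<rightarrow> a \<rightarrow> 0 \<rightarrow> 0\<close> of a null object of \<open>S\<close> by \<open>a\<close>.\<close>

lemma generating_subset_neighbourhood:
  assumes "strictly_full C S" "extension_generated C S"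
  shows "S \<subseteq> ext_star C S S"
proof
  fix a assume a: "a \<in> S"
  then have "a \<in> Ob C" using assms(1) by (auto simp: strictly_full_def)
  then show "a \<in> ext_star C S S"
    using generating_contains_null[OF assms] short_exact_Idn_null a unfolding ext_star_def by blast
qed

end

theorem theorem6p14:
  fixes A :: "('o, 'm) preadd_cat" and Z :: "('p, 'n) preadd_cat"
    and A\<^sub>0 :: "'o set" and \<Phi> :: "('o, 'm, 'p, 'n) cat_functor"
  assumes "abelian_category A"
    and "abelian_category Z"
    and "strictly_full A A\<^sub>0"
    and "extension_generated A A\<^sub>0"
    and "exact_functor A Z \<Phi>"
  shows "fully_faithful A Z \<Phi> \<longleftrightarrow>
    fully_faithful (full_subcategory A (Exk A A\<^sub>0 1)) Z
      (restrict_functor \<Phi> (full_subcategory A (Exk A A\<^sub>0 1)))"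
proof -
  interpret abelian_exact_functor A Z \<Phi>
    using assms by (simp add: abelian_exact_functor_def)
  let ?N = "ext_star A A\<^sub>0 A\<^sub>0"
  have N: "?N \<subseteq> Ob A" by (auto simp: ext_star_def)
  have restricted: "fully_faithful (full_subcategory A (Exk A A\<^sub>0 1)) Z
      (restrict_functor \<Phi> (full_subcategory A (Exk A A\<^sub>0 1))) \<longleftrightarrow>
    (\<forall>a \<in> ?N. \<forall>b \<in> ?N. bij_betw (FAr \<Phi>) (Hom A a b) (Hom Z (FOb \<Phi> a) (FOb \<Phi> b)))"
  proof -
    have "bij_betw (restrict (FAr \<Phi>) (Ar (full_subcategory A ?N))) (Hom A a b) Y \<longleftrightarrow>
        bij_betw (FAr \<Phi>) (Hom A a b) Y" if "a \<in> ?N" "b \<in> ?N" for a b Y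
      by (rule bij_betw_cong) (use that in \<open>auto simp: full_subcategory_def Hom_def\<close>)
    moreover have "Ob (full_subcategory A ?N) = ?N" by (simp add: full_subcategory_def)
    ultimately show ?thesis
      by (simp add: fully_faithful_def restrict_functor_def Hom_full_subcategory)
  qed
  show ?thesis
    unfolding restricted
  proof
    assume "fully_faithful A Z \<Phi>"
    then show "\<forall>a \<in> ?N. \<forall>b \<in> ?N. bij_betw (FAr \<Phi>) (Hom A a b) (Hom Z (FOb \<Phi> a) (FOb \<Phi> b))"
      using N by (auto simp: fully_faithful_def)
  next
    assume hom: "\<forall>a \<in> ?N. \<forall>b \<in> ?N. bij_betw (FAr \<Phi>) (Hom A a b) (Hom Z (FOb \<Phi> a) (FOb \<Phi> b))"
    have sub: "A\<^sub>0 \<subseteq> ?N" using dom.generating_subset_neighbourhood assms(3,4) .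
    have base: "hom_iso_ext1_injective A Z \<Phi> a b" if "a \<in> A\<^sub>0" "b \<in> A\<^sub>0" for a b
      using hom_iso_ext1_injective_if_neighbourhood[OF _ sub that] hom by blast
    have right: "hom_iso_ext1_injective A Z \<Phi> a b" if ab: "a \<in> A\<^sub>0" "b \<in> Ob A" for a b
    proof -
      obtain k where "b \<in> Exk A A\<^sub>0 k"
        using ab assms(4) by (auto simp: extension_generated_def)
      then show ?thesis
        using hom_iso_ext1_injective_Exk_right[of A\<^sub>0 a b k] base ab sub N by blast
    qed
    have "hom_iso_ext1_injective A Z \<Phi> a b" if ab: "a \<in> Ob A" "b \<in> Ob A" for a b
    proof -
      obtain k where "a \<in> Exk A A\<^sub>0 k"
        using ab assms(4) by (auto simp: extension_generated_def)
      then show ?thesis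
        using hom_iso_ext1_injective_Exk_left[of A\<^sub>0 b a k] right ab by blast
    qed
    then show "fully_faithful A Z \<Phi>"
      by (simp add: fully_faithful_def hom_iso_ext1_injective_def)
  qed
qed

end
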